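(* Let $(\tau_n)_{n=0}^\infty$ be the sequence of integers defined by $\tau_0:=1$, $\tau_1:=\tau_2:=2$, and $\tau_{n+1}:=\tau_n\tau_{n-1}-\tau_{n-2}$ for all $n\ge 2$. Let $(F_n)_{n=0}^\infty$ be the Fibonacci numbers, defined by $F_0:=0$, $F_1:=1$ and $F_{n+1}:=F_n+F_{n-1}$ for all $n\ge 1$. Define a real number $\alpha_*\in(0,1]$ by \[ \alpha_*:=\lim_{n\to\infty}\left(\frac{\tau_n^{F_{n+1}}}{\tau_{n+1}^{F_n}}\right)^{(-1)^n}=\prod_{n=1}^\infty\left(1-\frac{\tau_{n-1}}{\tau_n\tau_{n+1}}\right)^{(-1)^nF_{n+1}}. \] Then this infinite product converges unconditionally (and the displayed limit and product exist, are equal, and define a number in $(0,1]$), and the set of matrices \[ \mathsf{A}_{\alpha_*}:=\left\{\begin{pmatrix}1&1\\0&1\end{pmatrix},\ \alpha_*\begin{pmatrix}1&0\\1&1\end{pmatrix}\right\} \] does not have the finiteness property.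
   Context: For a finite set $\mathsf{A}=\{A_1,\dots,A_r\}$ of real $d\times d$ matrices, the joint spectral radius is \[\varrho(\mathsf{A}):=\limsup_{n\to\infty}\max\left\{\|A_{i_1}\cdots A_{i_n}\|^{1/n}\colon i_j\in\{1,\dots,r\}\right\},\] which does not depend on the choice of matrix norm $\|\cdot\|$. The set $\mathsf{A}$ has the finiteness property if there exist $n\ge1$ and $i_1,\dots,i_n\in\{1,\dots,r\}$ such that $\varrho(\mathsf{A})=\rho(A_{i_1}\cdots A_{i_n})^{1/n}$, where $\rho$ denotes the spectral radius of a matrix. *)

theory Defs
  imports "HOL-Analysis.Analysis" "HOL-Number_Theory.Fib"
begin

definition spectral_radius :: "real^'d^'d \<Rightarrow> real" where
  "spectral_radius A =
     Max {cmod z | z. \<exists>v::complex^'d. v \<noteq> 0 \<and> map_matrix complex_of_real A *v v = z *s v}"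

definition mat_prod :: "(real^'d^'d) list \<Rightarrow> real^'d^'d" where
  "mat_prod As = foldr (**) As (mat 1)"

text \<open>
  The matrix norm is the Euclidean operator norm; the joint spectral radius does not depend on
  this choice. Words \<open>i\<^sub>1 \<dots> i\<^sub>n\<close> are rendered as lists of length \<open>n\<close> of elements of the set.
  The definition is meant for finite nonempty sets of matrices, for which the maximum is taken over
  a finite nonempty set and the limit superior is finite. The value at \<open>n = 0\<close> is immaterial.
\<close>

definition joint_spectral_radius :: "(real^'d^'d) set \<Rightarrow> ereal" where
  "joint_spectral_radius A =
     limsup (\<lambda>n. ereal (Max {root n (onorm ((*v) (mat_prod As))) | As.
                               length As = n \<and> set As \<subseteq> A}))"

definition finiteness_property :: "(real^'d^'d) set \<Rightarrow> bool" where
  "finiteness_property A \<longleftrightarrow>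
     (\<exists>n\<ge>1. \<exists>As. length As = n \<and> set As \<subseteq> A \<and>
        joint_spectral_radius A = ereal (root n (spectral_radius (mat_prod As))))"

text \<open>
  Unconditional convergence: every rearrangement converges, to one and the same value. As usual for
  infinite products (and as in \<^const>\<open>has_prod\<close>), convergence to \<open>0\<close> in the absence of zero
  factors does not count.
\<close>

definition unconditionally_convergent_prod :: "(nat \<Rightarrow> real) \<Rightarrow> bool" where
  "unconditionally_convergent_prod f \<longleftrightarrow>
     (\<exists>p. \<forall>\<pi>. bij \<pi> \<longrightarrow> (f \<circ> \<pi>) has_prod p)"

fun tau :: "nat \<Rightarrow> int" where
  "tau 0 = 1"
| "tau (Suc 0) = 2"
| "tau (Suc (Suc 0)) = 2"
| "tau (Suc (Suc (Suc n))) = tau (Suc (Suc n)) * tau (Suc n) - tau n"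

definition alpha_seq :: "nat \<Rightarrow> real" where
  "alpha_seq n =
     (of_int (tau n) ^ fib (n + 1) / of_int (tau (n + 1)) ^ fib n) powi ((- 1) ^ n)"

text \<open>Only used for \<open>n \<ge> 1\<close>.\<close>

definition alpha_factor :: "nat \<Rightarrow> real" where
  "alpha_factor n =
     (1 - of_int (tau (n - 1)) / (of_int (tau n) * of_int (tau (n + 1))))
       powi ((- 1) ^ n * int (fib (n + 1)))"

definition alpha_star :: real where
  "alpha_star = lim alpha_seq"

definition A_alpha :: "real \<Rightarrow> (real^2^2) set" where
  "A_alpha \<alpha> = {vector [vector [1, 1], vector [0, 1]],
                \<alpha> *\<^sub>R vector [vector [1, 0], vector [1, 1]]}"

end

theory Submission
  imports Defs
begin

text \<open>
  Let \<open>A\<close> and \<open>B\<close> be the two unipotent matrices, and for a word \<open>w\<close> in these letters let \<open>\<rho>(w)\<close> be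
  the spectral radius of the product. Since \<open>\<alpha>\<close> only contributes one factor per letter \<open>B\<close>, the
  finiteness property asks whether a linear functional of the letter counts of \<open>w\<close> that dominates
  \<open>ln \<rho>(w)\<close> for all \<open>w\<close> can touch it. The growth rate \<open>ln \<rho>(w) / length w\<close>, maximised over words
  with prescribed letter frequency, is a strictly concave function of the frequency. A word has a
  rational frequency, so the property fails as soon as \<open>- ln \<alpha>\<close> is the slope of that function at
  an irrational point. The number \<open>\<alpha>\<^sub>*\<close> is the one for which the point is the golden frequency.

  Three ingredients make this precise with finite words only.

  The Fibonacci words \<open>B, A, AB, ABA, \<dots>\<close> have traces \<open>\<tau>\<^sub>1, \<tau>\<^sub>2, \<dots>\<close>, and a power of a Fibonacci
  word has the largest trace among all words with the same letter counts
  (\<open>fword_maximizes_trace\<close>). This is a renormalisation argument. In a cyclic word that contains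
  both \<open>AA\<close> and \<open>BB\<close>, reversing a suitable factor removes one occurrence of each and does not
  decrease the trace; so a word with at least as many \<open>A\<close> as \<open>B\<close> may be replaced by a word in \<open>AB\<close>
  and \<open>A\<close>. The sign condition that makes the exchange work, \<open>exchangeable\<close>, passes from the pair
  \<open>(A, B)\<close> to the pair \<open>(AB, A)\<close>, and iterating follows the Euclidean algorithm on the letter
  counts.

  Because the trace of \<open>V\<^sup>r W\<^sup>s\<close> is at least \<open>\<rho>(V)\<^sup>r \<rho>(W)\<^sup>s\<close> up to a bounded factor, maximality of
  Fibonacci words gives the concavity inequalities that are needed: if the letter counts of \<open>v\<close>
  plus \<open>j\<close> times those of a Fibonacci word \<open>w\<close> are \<open>c\<close> times those of a Fibonacci word \<open>z\<close>, then
  \<open>ln \<rho>(v) + j ln \<rho>(w) \<le> c ln \<rho>(z)\<close> (\<open>lrho_le_fword\<close>). The chord slopes between consecutive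
  Fibonacci words converge to \<open>- ln \<alpha>\<^sub>*\<close> so fast that the error tends to \<open>0\<close> even after
  multiplication with Fibonacci numbers (\<open>fib_slope_error_tendsto_0\<close>), because \<open>\<tau>\<close> grows doubly
  exponentially. The same growth makes the logarithms of the factors of the product absolutely
  summable, which gives unconditional convergence.

  Finally let \<open>h(v) \<ge> 0\<close> be the gap between the dominating linear functional and \<open>ln \<rho>(v)\<close>, and
  suppose that \<open>h(w) = 0\<close> for a word \<open>w\<close>. From some index on, every other Fibonacci word lies, in
  terms of frequency, between \<open>w\<close> and the golden point. On those words the concavity inequalities
  show both that the gap is nondecreasing and that it tends to \<open>0\<close>, so it vanishes. But the
  product of two such words \<open>x\<close>, \<open>z\<close> has \<open>\<rho>(xz) > \<rho>(x) \<rho>(z)\<close> by the Markov type equation for \<open>\<tau>\<close>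
  (\<open>lrho_concat_strict\<close>), so that its gap would be negative (\<open>no_word_attains_supremum\<close>).
\<close>

section \<open>Two by two matrices as a ring\<close>

text \<open>
  The trace arguments are noncommutative ring calculations with words, powers and products of
  lists. For vectors of vectors the type class product is the componentwise one, hence a separate
  type on which \<open>*\<close> is the matrix product.
\<close>
datatype mat2 = Mat2 (e11: real) (e12: real) (e21: real) (e22: real)

instantiation mat2 :: ring_1
begin
definition "0 = Mat2 0 0 0 0"
definition "1 = Mat2 1 0 0 1"
definition "X + Y = Mat2 (e11 X + e11 Y) (e12 X + e12 Y) (e21 X + e21 Y) (e22 X + e22 Y)"
definition "X - Y = Mat2 (e11 X - e11 Y) (e12 X - e12 Y) (e21 X - e21 Y) (e22 X - e22 Y)"
definition "- X = Mat2 (- e11 X) (- e12 X) (- e21 X) (- e22 X)"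
definition "X * Y = Mat2 (e11 X * e11 Y + e12 X * e21 Y) (e11 X * e12 Y + e12 X * e22 Y)
                         (e21 X * e11 Y + e22 X * e21 Y) (e21 X * e12 Y + e22 X * e22 Y)"
instance
  by standard
    (simp_all add: zero_mat2_def one_mat2_def plus_mat2_def minus_mat2_def uminus_mat2_def
      times_mat2_def algebra_simps)
end

lemma mat2_entries [simp]:
  "e11 (X * Y) = e11 X * e11 Y + e12 X * e21 Y" "e12 (X * Y) = e11 X * e12 Y + e12 X * e22 Y"
  "e21 (X * Y) = e21 X * e11 Y + e22 X * e21 Y" "e22 (X * Y) = e21 X * e12 Y + e22 X * e22 Y"
  "e11 (X - Y) = e11 X - e11 Y" "e12 (X - Y) = e12 X - e12 Y"
  "e21 (X - Y) = e21 X - e21 Y" "e22 (X - Y) = e22 X - e22 Y"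
  "e11 1 = 1" "e12 1 = 0" "e21 1 = 0" "e22 1 = 1"
  by (simp_all add: one_mat2_def minus_mat2_def times_mat2_def)

definition tr :: "mat2 \<Rightarrow> real" where "tr X = e11 X + e22 X"
definition dt :: "mat2 \<Rightarrow> real" where "dt X = e11 X * e22 X - e12 X * e21 X"

lemma dt_mult [simp]: "dt (X * Y) = dt X * dt Y"
  by (simp add: dt_def algebra_simps)

lemma dt_one [simp]: "dt 1 = 1"
  by (simp add: dt_def)

lemma tr_one [simp]: "tr 1 = 2"
  by (simp add: tr_def)

lemma tr_mult_commute: "tr (X * Y) = tr (Y * X)"
  by (simp add: tr_def algebra_simps)

lemma tr_minus [simp]: "tr (X - Y) = tr X - tr Y"
  by (simp add: tr_def)

lemma cayley_hamilton_tr: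
  assumes "dt X = 1"
  shows "tr (X * X * Z) = tr X * tr (X * Z) - tr Z"
proof -
  have "tr (X * X * Z) = tr X * tr (X * Z) - dt X * tr Z"
    unfolding tr_def dt_def by (simp add: algebra_simps)
  then show ?thesis using assms by simp
qed

text \<open>
  The commutator \<open>D = AB - BA\<close> satisfies \<open>AD = DA\<^sup>-\<^sup>1\<close>, because \<open>D\<close> and \<open>AD\<close> have trace \<open>0\<close>. This
  is what turns the exchange condition for \<open>(A, B)\<close> into the one for \<open>(AB, A)\<close>.
\<close>
lemma sandwich_commutator:
  assumes "dt A = 1"
  shows "A * (A * B - B * A) * A = A * B - B * A"
proof -
  have e: "e11 A * e22 A = 1 + e12 A * e21 A" using assms by (simp add: dt_def)
  show ?thesis
    by (rule mat2.expand, simp) (use e in \<open>(intro conjI; algebra)\<close>)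
qed

lemma cayley_hamilton_tr_right:
  assumes "dt X = 1"
  shows "tr (P * X ^ Suc (Suc s)) = tr X * tr (P * X ^ Suc s) - tr (P * X ^ s)"
proof -
  have "tr (P * X ^ Suc (Suc s)) = tr (X * X * (X ^ s * P))"
    using tr_mult_commute[of P "X ^ Suc (Suc s)"] by (simp add: mult.assoc)
  also have "\<dots> = tr X * tr (X * (X ^ s * P)) - tr (X ^ s * P)"
    using cayley_hamilton_tr[OF assms] .
  also have "tr (X * (X ^ s * P)) = tr (P * X ^ Suc s)"
    using tr_mult_commute[of P "X ^ Suc s"] by (simp add: mult.assoc)
  also have "tr (X ^ s * P) = tr (P * X ^ s)" by (rule tr_mult_commute)
  finally show ?thesis .
qed

text \<open>
  \<open>AB\<close> and \<open>BA\<close> have the same trace \<open>t \<ge> 2\<close>, so by Cayley and Hamilton \<open>(AB)\<^sup>s - (BA)\<^sup>s\<close> is a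
  nonnegative multiple of \<open>AB - BA\<close>, given by a Chebyshev polynomial in \<open>t\<close>. Hence the sign for \<open>s
  = 1\<close> decides all \<open>s\<close>.
\<close>
lemma tr_power_swap_le:
  assumes "dt A = 1" "dt B = 1" "tr (A * B) \<ge> 2" and le: "tr (P * (A * B)) \<le> tr (P * (B * A))"
  shows "tr (P * (A * B) ^ s) \<le> tr (P * (B * A) ^ s)"
proof -
  define f where "f s = tr (P * (A * B) ^ s) - tr (P * (B * A) ^ s)" for s
  have rec: "f (Suc (Suc s)) = tr (A * B) * f (Suc s) - f s" for s
    using cayley_hamilton_tr_right[of "A * B" P s] cayley_hamilton_tr_right[of "B * A" P s] assms
    by (simp add: f_def tr_mult_commute[of B A] algebra_simps del: power_Suc)
  have "f (Suc s) \<le> f s \<and> f s \<le> 0" for s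
  proof (induction s)
    case 0
    show ?case using le by (simp add: f_def)
  next
    case (Suc s)
    have "(tr (A * B) - 2) * f (Suc s) \<le> 0"
      using Suc assms by (intro mult_nonneg_nonpos) auto
    then show ?case using Suc rec[of s] by (simp add: algebra_simps)
  qed
  from this[of s] show ?thesis by (simp add: f_def)
qed

lemma tr_uminus [simp]: "tr (- X) = - tr X"
  by (simp add: tr_def uminus_mat2_def)

section \<open>Exchanging letters in words\<close>

definition word :: "mat2 \<Rightarrow> mat2 \<Rightarrow> bool list \<Rightarrow> mat2" where
  "word A B w = prod_list (map (\<lambda>b. if b then A else B) w)"

lemma word_simps [simp]:
  "word A B [] = 1" "word A B (b # w) = (if b then A else B) * word A B w"
  "word A B (v @ w) = word A B v * word A B w"
  by (simp_all add: word_def)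

lemma word_replicate [simp]: "word A B (replicate n b) = (if b then A else B) ^ n"
  by (induction n) auto

lemma word_concat_replicate [simp]: "word A B (concat (replicate n w)) = word A B w ^ n"
  by (induction n) auto

text \<open>
  For \<open>D = AB - BA\<close> the first two conditions say that replacing the factor \<open>AABB\<close> by \<open>ABAB\<close>, or
  \<open>BBAA\<close> by \<open>BABA\<close>, in a cyclic word over \<open>A, B\<close> does not decrease its trace. The last condition
  is the trace of \<open>D\<^sup>2 / 2\<close>; it is included because it covers the empty word in the step to \<open>(AB,
  A)\<close>.
\<close>
definition exchangeable :: "mat2 \<Rightarrow> mat2 \<Rightarrow> bool" where
  "exchangeable A B \<longleftrightarrow> dt A = 1 \<and> dt B = 1 \<and>
     (\<forall>z. tr (word A B z * (A * (A * B - B * A) * B)) \<le> 0) \<and>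
     (\<forall>z. tr (word A B z * (B * (A * B - B * A) * A)) \<ge> 0) \<and>
     tr (A * B * (A * B - B * A)) \<ge> 0"

lemma word_coarse:
  "\<exists>y. word (A * B) A z = word A B y \<and> (y = [] \<or> hd y)"
proof (induction z)
  case Nil
  show ?case by (rule exI[of _ "[]"]) simp
next
  case (Cons b z)
  then obtain y where "word (A * B) A z = word A B y" by blast
  then show ?case
    by (intro exI[of _ "(if b then [True, False] else [True]) @ y"]) (simp add: mult.assoc)
qed

text \<open>
  The commutator of \<open>AB\<close> and \<open>A\<close> is \<open>- AD\<close>. Moving factors around the trace and using \<open>ADA = D\<close>
  turns each of the first two conditions for \<open>(AB, A)\<close> into the other one for \<open>(A, B)\<close>, with
  opposite sign. A nonempty word over \<open>AB, A\<close> starts with \<open>A\<close>, which supplies the letter that is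
  needed there.
\<close>
lemma exchangeable_coarsen:
  assumes "exchangeable A B"
  shows "exchangeable (A * B) A"
proof -
  define D where "D = A * B - B * A"
  note ex = assms[unfolded exchangeable_def, folded D_def]
  have ADA: "A * D * A = D" unfolding D_def using ex by (intro sandwich_commutator) auto
  have D': "A * B * A - A * (A * B) = - (A * D)"
    by (simp add: D_def algebra_simps)
  have 1: "tr (word (A * B) A z * (A * B * (A * B * A - A * (A * B)) * A)) \<le> 0" for z
  proof -
    obtain y where y: "word (A * B) A z = word A B y" "y = [] \<or> hd y"
      using word_coarse by blast
    have "word (A * B) A z * (A * B * (A * B * A - A * (A * B)) * A)
        = - (word A B y * (A * B * (A * D * A)))"
      unfolding D' y by (simp add: mult.assoc)
    also have "\<dots> = - (word A B y * (A * B * D))"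
      unfolding ADA ..
    finally have eq: "tr (word (A * B) A z * (A * B * (A * B * A - A * (A * B)) * A))
        = - tr (word A B y * (A * B * D))"
      by simp
    show ?thesis
    proof (cases y)
      case Nil
      then show ?thesis using eq ex by simp
    next
      case (Cons b x)
      then have yx: "y = True # x" using y by simp
      have "tr (word A B y * (A * B * D)) = tr (A * (word A B x * A * B * D))"
        by (simp add: yx mult.assoc)
      also have "\<dots> = tr (word A B (x @ [True]) * (B * D * A))"
        by (subst tr_mult_commute) (simp add: mult.assoc)
      also have "\<dots> \<ge> 0" using ex by blast
      finally show ?thesis using eq by simp
    qed
  qed
  have 2: "tr (word (A * B) A z * (A * (A * B * A - A * (A * B)) * (A * B))) \<ge> 0" for z
  proof -
    obtain y where y: "word (A * B) A z = word A B y"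
      using word_coarse by blast
    have "word (A * B) A z * (A * (A * B * A - A * (A * B)) * (A * B))
        = - (word A B y * (A * (A * D * A) * B))"
      unfolding D' y by (simp add: mult.assoc)
    then have "tr (word (A * B) A z * (A * (A * B * A - A * (A * B)) * (A * B)))
        = - tr (word A B y * (A * D * B))"
      unfolding ADA by simp
    then show ?thesis using ex by simp
  qed
  have 3: "tr (A * B * A * (A * B * A - A * (A * B))) \<ge> 0"
  proof -
    have "tr (A * B * A * (A * B * A - A * (A * B))) = - tr (A * (B * A * A * D))"
      unfolding D' by (simp add: mult.assoc)
    also have "\<dots> = - tr (B * A * (A * D * A))"
      by (subst tr_mult_commute) (simp add: mult.assoc)
    also have "\<dots> = - tr (B * A * D)"
      unfolding ADA ..
    also have "\<dots> = tr (A * B * D)"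
      by (simp add: D_def tr_def algebra_simps)
    finally show ?thesis using ex by simp
  qed
  show ?thesis unfolding exchangeable_def using 1 2 3 ex by auto
qed

definition mat_A :: mat2 where "mat_A = Mat2 1 1 0 1"
definition mat_B :: mat2 where "mat_B = Mat2 1 0 1 1"

definition ge_one :: "mat2 \<Rightarrow> bool" where
  "ge_one X \<longleftrightarrow> 1 \<le> e11 X \<and> 0 \<le> e12 X \<and> 0 \<le> e21 X \<and> 1 \<le> e22 X"

lemma ge_one_mult_le:
  assumes "ge_one X" "ge_one Y"
  shows "e11 X \<le> e11 (X * Y)" "e12 X \<le> e12 (X * Y)" "e21 X \<le> e21 (X * Y)" "e22 X \<le> e22 (X * Y)"
    "e11 Y \<le> e11 (X * Y)" "e12 Y \<le> e12 (X * Y)" "e21 Y \<le> e21 (X * Y)" "e22 Y \<le> e22 (X * Y)"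
proof -
  have 1: "a \<le> a * b" if "0 \<le> a" "1 \<le> b" for a b :: real
    using mult_left_mono[of 1 b a] that by auto
  have 2: "a \<le> b * a" if "0 \<le> a" "1 \<le> b" for a b :: real
    using mult_right_mono[of 1 b a] that by auto
  have p: "0 \<le> a * b" if "0 \<le> a" "0 \<le> b" for a b :: real using that by simp
  have n: "0 \<le> e11 X" "0 \<le> e22 X" "0 \<le> e11 Y" "0 \<le> e22 Y"
    using assms by (auto simp: ge_one_def)
  note a = assms[unfolded ge_one_def]
  show "e11 X \<le> e11 (X * Y)" "e12 X \<le> e12 (X * Y)" "e21 X \<le> e21 (X * Y)" "e22 X \<le> e22 (X * Y)"
    using 1(1)[of "e11 X" "e11 Y"] 1(1)[of "e12 X" "e22 Y"] 1(1)[of "e21 X" "e11 Y"] 1(1)[of "e22 X" "e22 Y"]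
      p[of "e12 X" "e21 Y"] p[of "e11 X" "e12 Y"] p[of "e22 X" "e21 Y"] p[of "e21 X" "e12 Y"] a n
    unfolding mat2_entries by linarith+
  show "e11 Y \<le> e11 (X * Y)" "e12 Y \<le> e12 (X * Y)" "e21 Y \<le> e21 (X * Y)" "e22 Y \<le> e22 (X * Y)"
    using 2[of "e11 Y" "e11 X"] 2[of "e12 Y" "e11 X"] 2[of "e21 Y" "e22 X"] 2[of "e22 Y" "e22 X"]
      p[of "e12 X" "e21 Y"] p[of "e12 X" "e22 Y"] p[of "e21 X" "e11 Y"] p[of "e21 X" "e12 Y"] a n
    unfolding mat2_entries by linarith+
qed

lemma ge_one_mult: "ge_one X \<Longrightarrow> ge_one Y \<Longrightarrow> ge_one (X * Y)"
  using ge_one_mult_le(1-4)[of X Y] unfolding ge_one_def by (meson order_trans)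

abbreviation mat_of :: "bool list \<Rightarrow> mat2" where "mat_of \<equiv> word mat_A mat_B"

lemma ge_one_mat_of: "ge_one (mat_of w)"
proof (induction w)
  case Nil
  show ?case by (simp add: ge_one_def)
next
  case (Cons b w)
  have "ge_one (if b then mat_A else mat_B)" by (simp add: ge_one_def mat_A_def mat_B_def)
  then show ?case using Cons ge_one_mult by simp
qed

lemma dt_mat_A [simp]: "dt mat_A = 1" and dt_mat_B [simp]: "dt mat_B = 1"
  by (simp_all add: dt_def mat_A_def mat_B_def)

lemma dt_mat_of [simp]: "dt (mat_of w) = 1"
  by (induction w) auto

lemma tr_mat_of_ge_2: "tr (mat_of w) \<ge> 2"
  using ge_one_mat_of[of w] by (simp add: ge_one_def tr_def)

text \<open>
  Here \<open>D\<close> is diagonal with entries \<open>1, - 1\<close>, so that \<open>ADB\<close> has only nonpositive and \<open>BDA\<close> only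
  nonnegative entries, while products of \<open>A\<close> and \<open>B\<close> are nonnegative.
\<close>
lemma exchangeable_base: "exchangeable mat_A mat_B"
proof -
  have "tr (mat_of z * (mat_A * (mat_A * mat_B - mat_B * mat_A) * mat_B)) \<le> 0" for z
    using ge_one_mat_of[of z] by (simp add: tr_def mat_A_def mat_B_def ge_one_def)
  moreover have "tr (mat_of z * (mat_B * (mat_A * mat_B - mat_B * mat_A) * mat_A)) \<ge> 0" for z
    using ge_one_mat_of[of z] by (simp add: tr_def mat_A_def mat_B_def ge_one_def)
  moreover have "tr (mat_A * mat_B * (mat_A * mat_B - mat_B * mat_A)) \<ge> 0"
    by (simp add: tr_def mat_A_def mat_B_def)
  ultimately show ?thesis
    unfolding exchangeable_def by simp
qed

section \<open>Rewriting a word over A, B as a word over AB, A\<close>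

text \<open>
  Intermediate words in the passage from letters \<open>A, B\<close> to letters \<open>AB, A\<close>: each exchange fuses
  one \<open>A\<close> and one \<open>B\<close> into a block \<open>AB\<close>, until no single \<open>B\<close> is left.
\<close>
datatype block = Blk_A | Blk_B | Blk_AB

definition blocks :: "mat2 \<Rightarrow> mat2 \<Rightarrow> block list \<Rightarrow> mat2" where
  "blocks A B u = prod_list (map (case_block A B (A * B)) u)"

lemma blocks_simps [simp]:
  "blocks A B [] = 1" "blocks A B (b # u) = case_block A B (A * B) b * blocks A B u"
  "blocks A B (u @ v) = blocks A B u * blocks A B v"
  by (simp_all add: blocks_def)

lemma blocks_replicate_AB [simp]: "blocks A B (replicate n Blk_AB) = (A * B) ^ n"
  by (induction n) auto

text \<open>
  Going around the cyclic word, take a single \<open>A\<close> whose next neighbour other than \<open>AB\<close> is a single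
  \<open>B\<close>.
\<close>
lemma rotate_to_exchange:
  assumes "Blk_A \<in> set u" "Blk_B \<in> set u"
  obtains x y s z where "u = x @ y" "y @ x = Blk_A # replicate s Blk_AB @ Blk_B # z"
proof -
  \<comment> \<open>Start at some single \<open>A\<close>, go on to the first single \<open>B\<close> after it, and from there back to the
      last single \<open>A\<close> before that \<open>B\<close>.\<close>
  obtain p q where pq: "u = p @ Blk_A # q" using assms by (meson split_list)
  have "Blk_B \<in> set (q @ p)" using assms pq by auto
  then obtain q1 q2 where q12: "q @ p = q1 @ Blk_B # q2" "Blk_B \<notin> set q1" by (meson split_list_first)
  obtain r1 r2 where r: "Blk_A # q1 = r1 @ Blk_A # r2" "Blk_A \<notin> set r2"
    by (meson split_list_last list.set_intros(1))
  have "set r2 \<subseteq> {Blk_AB}"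
  proof
    fix b assume b: "b \<in> set r2"
    have "set r2 \<subseteq> set q1" using r(1) by (cases r1) auto
    then have "b \<noteq> Blk_B" "b \<noteq> Blk_A" using b q12 r by auto
    then show "b \<in> {Blk_AB}" by (cases b) auto
  qed
  then have r2: "replicate (length r2) Blk_AB = r2" by (intro replicate_length_same) auto
  have rot: "Blk_A # q @ p = r1 @ Blk_A # r2 @ Blk_B # q2" using q12 r by (metis append_Cons append_assoc)
  \<comment> \<open>The rotation starts at the \<open>A\<close> found last, which may lie on either side of the seam of \<open>u\<close>.\<close>
  then have "(Blk_A # q) @ p = r1 @ (Blk_A # r2 @ Blk_B # q2)" by simp
  then consider t where "Blk_A # q = r1 @ t" "t @ p = Blk_A # r2 @ Blk_B # q2"
    | t where "(Blk_A # q) @ t = r1" "p = t @ Blk_A # r2 @ Blk_B # q2"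
    unfolding append_eq_append_conv2 by blast
  then show ?thesis
  proof cases
    case (1 t)
    have "u = (p @ r1) @ t" using pq 1(1) by simp
    moreover have "t @ p @ r1 = Blk_A # replicate (length r2) Blk_AB @ Blk_B # (q2 @ r1)"
    proof -
      have "t @ p @ r1 = (t @ p) @ r1" by simp
      also have "\<dots> = Blk_A # r2 @ Blk_B # (q2 @ r1)" unfolding 1(2) by simp
      finally show ?thesis by (subst r2) simp
    qed
    ultimately show ?thesis using that by blast
  next
    case (2 t)
    have "u = t @ ((Blk_A # r2 @ Blk_B # q2) @ Blk_A # q)" using pq 2(2) by simp
    moreover have "((Blk_A # r2 @ Blk_B # q2) @ Blk_A # q) @ t = Blk_A # replicate (length r2) Blk_AB @ Blk_B # (q2 @ Blk_A # q @ t)"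
      by (subst r2) simp
    ultimately show ?thesis using that by blast
  qed
qed

text \<open>
  Induction on the number of single \<open>B\<close>. A cyclic factor \<open>A (AB)\<^sup>s B\<close> is replaced by \<open>A (BA)\<^sup>s B =
  (AB)\<^sup>s\<^sup>+\<^sup>1\<close>, where the trace does not decrease by the exchange condition.
\<close>
lemma exchange_reduces:
  assumes ex: "exchangeable A B" and t: "tr (A * B) \<ge> 2"
    and "count_list u Blk_B \<le> count_list u Blk_A"
  shows "\<exists>v. count_list v True = count_list u Blk_AB + count_list u Blk_B
           \<and> count_list v False + count_list u Blk_B = count_list u Blk_A
           \<and> tr (blocks A B u) \<le> tr (word (A * B) A v)"
  using assms(3)
proof (induction "count_list u Blk_B" arbitrary: u)
  case 0
  have "Blk_B \<notin> set u" using 0 by (metis count_list_0_iff)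
  then have "\<exists>v. count_list v True = count_list u Blk_AB \<and> count_list v False = count_list u Blk_A
           \<and> blocks A B u = word (A * B) A v"
  proof (induction u)
    case Nil
    show ?case by (rule exI[of _ "[]"]) simp
  next
    case (Cons b u)
    then obtain v where "count_list v True = count_list u Blk_AB" "count_list v False = count_list u Blk_A"
      "blocks A B u = word (A * B) A v" by auto
    with Cons.prems show ?case
      by (intro exI[of _ "(b = Blk_AB) # v"]) (cases b; simp)
  qed
  with 0 show ?case by fastforce
next
  case (Suc n)
  have "Blk_B \<in> set u" using Suc.hyps(2) by (metis count_list_0_iff nat.distinct(1))
  moreover have "Blk_A \<in> set u" using Suc.hyps(2) Suc.prems
    by (metis count_list_0_iff le_zero_eq nat.distinct(1))
  ultimately obtain x y s z where xy: "u = x @ y" "y @ x = Blk_A # replicate s Blk_AB @ Blk_B # z"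
    using rotate_to_exchange by blast
  define u' where "u' = replicate (Suc s) Blk_AB @ z"
  have cnt: "count_list u b = count_list (Blk_A # replicate s Blk_AB @ Blk_B # z) b" for b
    using arg_cong[OF xy(2), of "\<lambda>l. count_list l b"] by (simp add: xy(1))
  have rep: "count_list (replicate s Blk_AB) b = (if b = Blk_AB then s else 0)" for b
    by (induction s) auto
  have c: "count_list u Blk_B = Suc (count_list u' Blk_B)" "count_list u Blk_A = Suc (count_list u' Blk_A)"
    "count_list u' Blk_AB = Suc (count_list u Blk_AB)"
    unfolding cnt u'_def by (simp_all add: rep)
  have z: "\<exists>z'. blocks A B z = word A B z'"
  proof (induction z)
    case Nil
    show ?case by (rule exI[of _ "[]"]) simp
  next
    case (Cons b z)
    then obtain z' where "blocks A B z = word A B z'" by blast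
    then show ?case
      by (intro exI[of _ "(case b of Blk_A \<Rightarrow> [True] | Blk_B \<Rightarrow> [False] | Blk_AB \<Rightarrow> [True, False]) @ z'"])
         (cases b; simp add: mult.assoc)
  qed
  then obtain z' where z': "blocks A B z = word A B z'" by blast
  \<comment> \<open>The trace of \<open>u\<close> is that of \<open>P (AB)\<^sup>s\<close>: the rest of the cyclic word together with the outer \<open>A\<close> and \<open>B\<close>.\<close>
  define P where "P = B * blocks A B z * A"
  have D: "tr (P * (A * B)) \<le> tr (P * (B * A))"
  proof -
    have "tr (P * (A * B)) - tr (P * (B * A)) = tr (P * (A * B - B * A))"
      by (simp add: right_diff_distrib)
    also have "\<dots> = tr (B * (blocks A B z * A * (A * B - B * A)))"
      by (simp only: P_def mult.assoc)
    also have "\<dots> = tr (blocks A B z * (A * (A * B - B * A) * B))"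
      by (subst tr_mult_commute) (simp only: mult.assoc)
    also have "\<dots> \<le> 0" using ex z' unfolding exchangeable_def by simp
    finally show ?thesis by simp
  qed
  have "tr (blocks A B u) = tr (blocks A B (y @ x))"
    by (simp add: xy(1) tr_mult_commute)
  also have "\<dots> = tr ((A * (A * B) ^ s) * (B * blocks A B z))"
    unfolding xy(2) by (simp add: mult.assoc)
  also have "\<dots> = tr (P * (A * B) ^ s)"
    by (subst tr_mult_commute) (simp add: P_def mult.assoc)
  also have "\<dots> \<le> tr (P * (B * A) ^ s)"
    using ex t D unfolding exchangeable_def by (intro tr_power_swap_le) auto
  also have "\<dots> = tr (B * blocks A B z * (A * (B * A) ^ s))"
    by (simp add: P_def mult.assoc)
  also have "\<dots> = tr (A * (B * A) ^ s * B * blocks A B z)"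
    by (subst tr_mult_commute) (simp add: mult.assoc)
  also have "A * (B * A) ^ s * B = (A * B) ^ Suc s"
    by (induction s) (simp_all add: mult.assoc)
  also have "(A * B) ^ Suc s * blocks A B z = blocks A B u'"
    by (simp add: u'_def mult.assoc)
  finally have le: "tr (blocks A B u) \<le> tr (blocks A B u')" .
  have "\<exists>v. count_list v True = count_list u' Blk_AB + count_list u' Blk_B
           \<and> count_list v False + count_list u' Blk_B = count_list u' Blk_A
           \<and> tr (blocks A B u') \<le> tr (word (A * B) A v)"
    using Suc.hyps(2) Suc.prems c by (intro Suc.hyps(1)) auto
  then obtain v where "count_list v True = count_list u' Blk_AB + count_list u' Blk_B"
     "count_list v False + count_list u' Blk_B = count_list u' Blk_A"
     "tr (blocks A B u') \<le> tr (word (A * B) A v)" by blast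
  with c le show ?case by (intro exI[of _ v]) auto
qed

lemma coarsen_word:
  assumes "exchangeable A B" "tr (A * B) \<ge> 2" "count_list w False \<le> count_list w True"
  obtains v where "count_list v True = count_list w False"
    "count_list v False + count_list w False = count_list w True"
    "tr (word A B w) \<le> tr (word (A * B) A v)"
proof -
  define u where "u = map (\<lambda>b. if b then Blk_A else Blk_B) w"
  have "count_list u Blk_B = count_list w False" "count_list u Blk_A = count_list w True"
    "count_list u Blk_AB = 0" "blocks A B u = word A B w"
    unfolding u_def by (induction w) auto
  with exchange_reduces[OF assms(1,2), of u] assms(3) obtain v where
    "count_list v True = count_list w False" "count_list v False + count_list w False = count_list w True"
    "tr (word A B w) \<le> tr (word (A * B) A v)" by auto
  then show ?thesis by (rule that)
qed

section \<open>Powers of Fibonacci words maximise the trace\<close>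

fun fword :: "nat \<Rightarrow> bool list" where
  "fword 0 = [False]"
| "fword (Suc 0) = [True]"
| "fword (Suc (Suc n)) = fword (Suc n) @ fword n"

abbreviation fmat :: "nat \<Rightarrow> mat2" where "fmat n \<equiv> mat_of (fword n)"

lemma exchangeable_fmat: "exchangeable (fmat (Suc k)) (fmat k)"
proof (induction k)
  case 0
  then show ?case using exchangeable_base by simp
next
  case (Suc k)
  then show ?case using exchangeable_coarsen[OF Suc] by simp
qed

text \<open>
  With letter counts \<open>c F\<^sub>m\<^sub>+\<^sub>1, c F\<^sub>m\<close> over two consecutive Fibonacci words, coarsening yields
  counts \<open>c F\<^sub>m, c F\<^sub>m\<^sub>-\<^sub>1\<close> over the next two, until only the power of a single word remains.
\<close>
lemma fword_maximizes_trace_aux: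
  assumes "count_list v True = c * fib (Suc m)" "count_list v False = c * fib m"
  shows "tr (word (fmat (Suc k)) (fmat k) v) \<le> tr (fmat (k + Suc m) ^ c)"
  using assms
proof (induction m arbitrary: k v)
  case 0
  have "v = replicate c True"
  proof -
    have "False \<notin> set v" using 0 by (metis count_list_0_iff fib0 mult_0_right)
    then have v: "replicate (length v) True = v"
      by (intro replicate_length_same) (metis (full_types))
    have "count_list (replicate n True) True = n" for n
      by (induction n) auto
    then have "length v = c" using 0(1) v by (metis fib_1 mult.right_neutral One_nat_def)
    then show ?thesis using v by simp
  qed
  then show ?case by simp
next
  case (Suc m)
  have "2 \<le> tr (fmat (Suc k) * fmat k)"
    using tr_mat_of_ge_2[of "fword (Suc k) @ fword k"] by simp
  moreover have "count_list v False \<le> count_list v True" using Suc.prems by simp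
  ultimately obtain u where u: "count_list u True = count_list v False"
    "count_list u False + count_list v False = count_list v True"
    "tr (word (fmat (Suc k)) (fmat k) v) \<le> tr (word (fmat (Suc k) * fmat k) (fmat (Suc k)) u)"
    using coarsen_word exchangeable_fmat by metis
  have "tr (word (fmat (Suc (Suc k))) (fmat (Suc k)) u) \<le> tr (fmat (Suc k + Suc m) ^ c)"
    using u Suc.prems by (intro Suc.IH) (simp_all add: algebra_simps)
  with u show ?case by simp
qed

lemma fword_maximizes_trace:
  assumes "count_list v True = c * fib (Suc m)" "count_list v False = c * fib m"
  shows "tr (mat_of v) \<le> tr (fmat (Suc m) ^ c)"
  using fword_maximizes_trace_aux[OF assms, of 0] by simp

section \<open>Spectral radii of words and their superadditivity\<close>

text \<open>
  The larger root of \<open>x\<^sup>2 - t x + 1\<close>, that is, the spectral radius of a matrix with determinant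
  \<open>1\<close> and trace \<open>t \<ge> 2\<close>.
\<close>
definition lam :: "real \<Rightarrow> real" where "lam t = (t + sqrt (t\<^sup>2 - 4)) / 2"

lemma lam_facts:
  assumes "t \<ge> 2"
  shows lam_ge_1: "lam t \<ge> 1" and lam_plus_inverse: "lam t + 1 / lam t = t" and lam_le: "lam t \<le> t"
    and lam_ge_half: "t \<le> 2 * lam t"
proof -
  have t4: "t\<^sup>2 - 4 \<ge> 0" using assms power_mono[of 2 t 2] by simp
  define q where "q = sqrt (t\<^sup>2 - 4)"
  have q: "q \<ge> 0" "q * q = t * t - 4" using t4 by (simp_all add: q_def power2_eq_square[symmetric])
  have l: "lam t = (t + q) / 2" by (simp add: lam_def q_def)
  show 1: "lam t \<ge> 1" "t \<le> 2 * lam t" unfolding l using assms q by auto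
  have "lam t * (t - lam t) = 1" unfolding l using q by (simp add: field_simps)
  then show 2: "lam t + 1 / lam t = t" using 1 by (simp add: field_simps)
  then show "lam t \<le> t" using 1 by (smt (verit) divide_nonneg_nonneg)
qed

lemma tr_power:
  assumes "dt X = 1" "tr X \<ge> 2"
  shows "tr (X ^ r) = lam (tr X) ^ r + (1 / lam (tr X)) ^ r"
proof -
  define l where "l = lam (tr X)"
  have l: "l \<ge> 1" "l + 1 / l = tr X" using assms lam_facts unfolding l_def by auto
  have "tr (X ^ r) = l ^ r + (1 / l) ^ r \<and> tr (X ^ Suc r) = l ^ Suc r + (1 / l) ^ Suc r" for r
  proof (induction r)
    case 0
    show ?case using l by simp
  next
    case (Suc r)
    have "tr (X ^ Suc (Suc r)) = tr X * tr (X ^ Suc r) - tr (X ^ r)"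
      using cayley_hamilton_tr_right[OF assms(1), of 1 r] by simp
    also have "\<dots> = (l + 1 / l) * (l ^ Suc r + (1 / l) ^ Suc r) - (l ^ r + (1 / l) ^ r)"
      using Suc l by metis
    also have "\<dots> = l ^ Suc (Suc r) + (1 / l) ^ Suc (Suc r)"
      using l(1) by (simp add: field_simps)
    finally show ?case using Suc by blast
  qed
  then show ?thesis unfolding l_def by blast
qed

abbreviation rho :: "bool list \<Rightarrow> real" where "rho w \<equiv> lam (tr (mat_of w))"

lemma rho_ge_1: "rho w \<ge> 1"
  using lam_ge_1 tr_mat_of_ge_2 .

definition lrho :: "bool list \<Rightarrow> real" where "lrho w = ln (rho w)"

lemma tr_power_ge: "rho w ^ r \<le> tr (mat_of w ^ r)"
  using tr_power[OF dt_mat_of tr_mat_of_ge_2, of w r] rho_ge_1[of w] by simp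

lemma tr_power_le: "tr (mat_of w ^ r) \<le> 2 * rho w ^ r"
proof -
  have "(1 / rho w) ^ r \<le> 1" using rho_ge_1[of w] by (intro power_le_one) auto
  also have "1 \<le> rho w ^ r" using rho_ge_1 by simp
  finally show ?thesis using tr_power[OF dt_mat_of tr_mat_of_ge_2, of w r] by simp
qed

definition all_ge_one :: "mat2 \<Rightarrow> bool" where
  "all_ge_one X \<longleftrightarrow> 1 \<le> e11 X \<and> 1 \<le> e12 X \<and> 1 \<le> e21 X \<and> 1 \<le> e22 X"

lemma ge_one_power: "ge_one X \<Longrightarrow> ge_one (X ^ n)"
  by (induction n) (auto intro: ge_one_mult simp: ge_one_def[of 1])

text \<open>
  Every entry of \<open>WUW\<close> contains \<open>U\<^sub>1\<^sub>1\<close> and \<open>U\<^sub>2\<^sub>2\<close> with coefficients at least \<open>1\<close>.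
\<close>
lemma sandwich_entries_ge_tr:
  assumes "all_ge_one W" "ge_one U"
  shows "tr U \<le> e11 (W * U * W)" "tr U \<le> e22 (W * U * W)" "0 \<le> e12 (W * U * W)" "0 \<le> e21 (W * U * W)"
proof -
  have g: "x \<le> a * x * b" if "1 \<le> a" "1 \<le> b" "0 \<le> x" for a b x :: real
    using mult_mono[of 1 a 1 b] mult_right_mono[of 1 "a * b" x] that by (simp add: algebra_simps)
  note W = assms(1)[unfolded all_ge_one_def] and U = assms(2)[unfolded ge_one_def]
  have p: "0 \<le> a * x * b" if "1 \<le> a" "1 \<le> b" "0 \<le> x" for a b x :: real
    using g[OF that] that by linarith
  have u: "0 \<le> e11 U" "0 \<le> e22 U" using U by auto
  have "e11 (W * U * W) = e11 W * e11 U * e11 W + e12 W * e21 U * e11 W + e11 W * e12 U * e21 W + e12 W * e22 U * e21 W"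
    by (simp add: algebra_simps)
  moreover have "e22 (W * U * W) = e21 W * e11 U * e12 W + e22 W * e21 U * e12 W + e21 W * e12 U * e22 W + e22 W * e22 U * e22 W"
    by (simp add: algebra_simps)
  ultimately show "tr U \<le> e11 (W * U * W)" "tr U \<le> e22 (W * U * W)"
    using g[of "e11 W" "e11 W" "e11 U"] p[of "e12 W" "e11 W" "e21 U"] p[of "e11 W" "e21 W" "e12 U"]
      g[of "e12 W" "e21 W" "e22 U"] g[of "e21 W" "e12 W" "e11 U"] p[of "e22 W" "e12 W" "e21 U"]
      p[of "e21 W" "e22 W" "e12 U"] g[of "e22 W" "e22 W" "e22 U"] W U u
    unfolding tr_def by linarith+
  show "0 \<le> e12 (W * U * W)" "0 \<le> e21 (W * U * W)"
    using W U u by auto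
qed

text \<open>
  Of the factors of \<open>W\<^sup>q\<^sup>+\<^sup>2\<close> the outer two are spent on making the entries of the power
  comparable to its trace. The loss of \<open>\<rho>(W)\<^sup>2\<close> does not depend on the exponents and disappears in
  the limit.
\<close>
lemma tr_mult_power_ge:
  assumes "all_ge_one (mat_of w)"
  shows "rho v ^ r * rho w ^ q \<le> tr (mat_of v ^ r * mat_of w ^ (q + 2))"
proof -
  define V where "V = mat_of v ^ r"
  define M where "M = mat_of w * mat_of w ^ q * mat_of w"
  have V: "ge_one V" unfolding V_def by (intro ge_one_power ge_one_mat_of)
  have W: "ge_one (mat_of w ^ q)" by (intro ge_one_power ge_one_mat_of)
  note M = sandwich_entries_ge_tr[OF assms W, folded M_def]
  have t: "0 \<le> tr (mat_of w ^ q)" using W by (auto simp: ge_one_def tr_def)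
  have "rho v ^ r * rho w ^ q \<le> tr V * tr (mat_of w ^ q)"
    using rho_ge_1[of v] rho_ge_1[of w] tr_power_ge[of v r] tr_power_ge[of w q] V
    by (intro mult_mono) (auto simp: V_def[symmetric] ge_one_def tr_def)
  also have "\<dots> = e11 V * tr (mat_of w ^ q) + e22 V * tr (mat_of w ^ q)" by (simp add: tr_def algebra_simps)
  also have "\<dots> \<le> e11 V * e11 M + e22 V * e22 M"
    using V M by (intro add_mono mult_left_mono) (auto simp: ge_one_def)
  also have "\<dots> \<le> tr (V * M)"
    using V M by (auto simp: tr_def ge_one_def)
  also have "M = mat_of w ^ (q + 2)"
    unfolding M_def by (simp add: power_add power2_eq_square power_commutes mult.assoc)
  finally show ?thesis unfolding V_def .
qed

text \<open>
  Take logarithms, divide by \<open>r\<close> and let \<open>r\<close> tend to infinity.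
\<close>
lemma lrho_superadditive:
  assumes pos: "all_ge_one (mat_of w)" and "j \<ge> 1"
    and le: "\<And>r. tr (mat_of v ^ r * mat_of w ^ (j * r)) \<le> tr (mat_of z ^ (c * r))"
  shows "lrho v + real j * lrho w \<le> real c * lrho z"
proof (rule ccontr)
  define e where "e = lrho v + real j * lrho w - real c * lrho z"
  assume "\<not> ?thesis"
  then have "e > 0" by (simp add: e_def)
  then obtain n :: nat where n: "ln 2 + 2 * lrho w < real n * e" using reals_Archimedean3 by blast
  define r where "r = n + 2"
  have jr: "j * r - 2 + 2 = j * r" using \<open>j \<ge> 1\<close> unfolding r_def
    by (metis add.commute le_add2 le_add_diff_inverse mult_le_mono1 nat_mult_1 order_trans)
  have "rho v ^ r * rho w ^ (j * r - 2) \<le> tr (mat_of v ^ r * mat_of w ^ (j * r))"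
    using tr_mult_power_ge[OF pos, of v r "j * r - 2"] unfolding jr .
  also have "\<dots> \<le> 2 * rho z ^ (c * r)" using le tr_power_le order_trans by blast
  finally have "ln (rho v ^ r * rho w ^ (j * r - 2)) \<le> ln (2 * rho z ^ (c * r))"
    using rho_ge_1 by (subst ln_le_cancel_iff) (auto intro!: mult_pos_pos zero_less_power intro: less_le_trans[OF zero_less_one])
  moreover have p: "0 < rho x" for x using rho_ge_1[of x] by linarith
  moreover have "ln (rho v ^ r * rho w ^ (j * r - 2)) = real r * lrho v + real (j * r - 2) * lrho w"
    using p[of v] p[of w] unfolding lrho_def
    by (subst ln_mult_pos) (auto simp only: ln_realpow zero_less_power)
  moreover have "ln (2 * rho z ^ (c * r)) = ln 2 + real (c * r) * lrho z"
    using p[of z] unfolding lrho_def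
    by (subst ln_mult_pos) (auto simp only: ln_realpow zero_less_power zero_less_numeral)
  ultimately have "real r * lrho v + real (j * r - 2) * lrho w \<le> ln 2 + real (c * r) * lrho z"
    by linarith
  moreover have "real (j * r - 2) = real j * real r - 2" using jr by (metis add_diff_cancel_right' of_nat_add of_nat_mult of_nat_numeral)
  ultimately have "real r * e \<le> ln 2 + 2 * lrho w" by (simp add: e_def algebra_simps)
  moreover have "real n * e \<le> real r * e" using \<open>e > 0\<close> by (simp add: r_def)
  ultimately show False using n by linarith
qed

lemma count_fword_True: "count_list (fword n) True = fib n"
  by (induction n rule: fword.induct) auto

lemma count_fword_False: "count_list (fword (Suc n)) False = fib n"
proof (induction n rule: fib.induct)
  case (3 n)
  have "count_list (fword (Suc (Suc (Suc n)))) False = count_list (fword (Suc (Suc n))) False + count_list (fword (Suc n)) False"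
    by (subst fword.simps(3)) (simp only: count_list_append)
  with 3 show ?case by simp
qed auto

lemma count_concat_replicate: "count_list (concat (replicate n w)) b = n * count_list w b"
  by (induction n) auto

text \<open>
  The concavity inequality: \<open>r\<close> copies of \<open>v\<close> and \<open>j r\<close> copies of \<open>w\<close> form a word with the letter
  counts of the power \<open>c r\<close> of the Fibonacci word, which has the largest trace.
\<close>
lemma lrho_le_fword:
  assumes pos: "all_ge_one (mat_of w)" and j: "j \<ge> 1"
    and T: "count_list v True + j * count_list w True = c * fib (Suc m)"
    and F: "count_list v False + j * count_list w False = c * fib m"
  shows "lrho v + real j * lrho w \<le> real c * lrho (fword (Suc m))"
proof (rule lrho_superadditive[OF pos j])
  fix r
  define u where "u = concat (replicate r v) @ concat (replicate (j * r) w)"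
  have "count_list u True = c * r * fib (Suc m)"
    using arg_cong[OF T, of "\<lambda>x. x * r"] by (simp add: u_def count_concat_replicate algebra_simps)
  moreover have "count_list u False = c * r * fib m"
    using arg_cong[OF F, of "\<lambda>x. x * r"] by (simp add: u_def count_concat_replicate algebra_simps)
  ultimately have "tr (mat_of u) \<le> tr (fmat (Suc m) ^ (c * r))" by (rule fword_maximizes_trace)
  then show "tr (mat_of v ^ r * mat_of w ^ (j * r)) \<le> tr (fmat (Suc m) ^ (c * r))" by (simp add: u_def)
qed

text \<open>
  From \<open>AB\<close> on; the words \<open>B\<close> and \<open>A\<close> themselves are triangular.
\<close>
lemma all_ge_one_fmat: "all_ge_one (fmat (Suc (Suc k)))"
proof (induction k)
  case 0
  show ?case by (simp add: all_ge_one_def mat_A_def mat_B_def)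
next
  case (Suc k)
  have "ge_one (fmat (Suc (Suc k)))" "ge_one (fmat (Suc k))" by (rule ge_one_mat_of)+
  from ge_one_mult_le(1-4)[OF this] Suc show ?case
    unfolding all_ge_one_def fword.simps(3)[of "Suc k"] word_simps(3) by linarith
qed

section \<open>The joint spectral radius dominates the growth of every word\<close>

definition to_mat :: "mat2 \<Rightarrow> real^2^2" where
  "to_mat X = vector [vector [e11 X, e12 X], vector [e21 X, e22 X]]"

lemma to_mat_mult: "to_mat (X * Y) = to_mat X ** to_mat Y"
  by (simp add: to_mat_def vec_eq_iff forall_2 matrix_matrix_mult_def sum_2)

lemma to_mat_one: "to_mat 1 = mat 1"
  by (simp add: to_mat_def vec_eq_iff forall_2 mat_def)

definition letter :: "real \<Rightarrow> bool \<Rightarrow> real^2^2" where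
  "letter \<alpha> b = (if b then to_mat mat_A else \<alpha> *\<^sub>R to_mat mat_B)"

lemma A_alpha_eq: "A_alpha \<alpha> = range (letter \<alpha>)"
  by (auto simp: A_alpha_def letter_def to_mat_def mat_A_def mat_B_def UNIV_bool)

lemma mat_prod_letters:
  "mat_prod (map (letter \<alpha>) w) = \<alpha> ^ count_list w False *\<^sub>R to_mat (mat_of w)"
proof (induction w)
  case Nil
  show ?case by (simp add: mat_prod_def to_mat_one)
next
  case (Cons b w)
  have "mat_prod (map (letter \<alpha>) (b # w)) = letter \<alpha> b ** mat_prod (map (letter \<alpha>) w)"
    by (simp add: mat_prod_def)
  also have "\<dots> = letter \<alpha> b ** (\<alpha> ^ count_list w False *\<^sub>R to_mat (mat_of w))"
    using Cons by simp
  also have "\<dots> = \<alpha> ^ count_list (b # w) False *\<^sub>R to_mat (mat_of (b # w))"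
    by (cases b) (simp_all add: letter_def to_mat_mult vec_eq_iff forall_2 matrix_matrix_mult_def sum_2 algebra_simps)
  finally show ?case .
qed

text \<open>
  The eigenvalues are \<open>c l\<close> and \<open>c / l\<close> for \<open>l = lam (tr X)\<close>, and \<open>l \<ge> 1\<close>.
\<close>
lemma spectral_radius_to_mat:
  assumes c: "c > 0" and d: "dt X = 1" and t: "tr X \<ge> 2"
  shows "spectral_radius (c *\<^sub>R to_mat X) = c * lam (tr X)"
proof -
  define l where "l = lam (tr X)"
  have l: "l \<ge> 1" "l + 1 / l = tr X" using lam_facts t unfolding l_def by auto
  obtain a b p q where X: "X = Mat2 a b p q" by (cases X)
  have dd: "a * q - b * p = 1" "a + q = l + 1 / l" using d l(2) by (simp_all add: X dt_def tr_def)
  define S where "S = {cmod z | z. \<exists>v::complex^2. v \<noteq> 0 \<and>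
      map_matrix complex_of_real (c *\<^sub>R to_mat X) *v v = z *s v}"
  have eig: "map_matrix complex_of_real (c *\<^sub>R to_mat X) *v v = z *s v \<longleftrightarrow>
      c * a * v $ 1 + c * b * v $ 2 = z * v $ 1 \<and> c * p * v $ 1 + c * q * v $ 2 = z * v $ 2" for v z
    by (simp add: X to_mat_def vec_eq_iff forall_2 matrix_vector_mult_def sum_2 map_matrix_def)
  have ll: "l * l - (a + q) * l + 1 = 0" using l(1) unfolding dd(2) by (simp add: field_simps)
  have "c * l \<in> S"
  proof -
    \<comment> \<open>An explicit eigenvector comes from whichever row of \<open>X - l\<close> is visibly nonzero.\<close>
    have *: "c * l \<in> S" if "x \<noteq> 0 \<or> y \<noteq> 0" "a * x + b * y = l * x" "p * x + q * y = l * y" for x y :: real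
    proof -
      define v :: "complex^2" where "v = vector [of_real x, of_real y]"
      have "v \<noteq> 0" using that(1) by (auto simp: v_def vec_eq_iff forall_2)
      have "complex_of_real (c * (a * x + b * y)) = of_real (c * (l * x))"
        "complex_of_real (c * (p * x + q * y)) = of_real (c * (l * y))"
        using that(2,3) by simp_all
      then have "map_matrix complex_of_real (c *\<^sub>R to_mat X) *v v = complex_of_real (c * l) *s v"
        unfolding eig by (simp add: v_def algebra_simps)
      with \<open>v \<noteq> 0\<close> have "cmod (complex_of_real (c * l)) \<in> S" unfolding S_def by blast
      moreover have "cmod (complex_of_real (c * l)) = c * l" using c l by (simp add: norm_mult)
      ultimately show ?thesis by simp
    qed
    consider "b \<noteq> 0" | "p \<noteq> 0" | "b = 0" "p = 0" by blast
    then show ?thesis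
    proof cases
      case 1
      show ?thesis by (rule *[of b "l - a"]) (use 1 dd(1) ll in \<open>auto simp: algebra_simps\<close>)
    next
      case 2
      show ?thesis by (rule *[of "l - q" p]) (use 2 dd(1) ll in \<open>auto simp: algebra_simps\<close>)
    next
      case 3
      have "(l - a) * (l - q) = 0" using dd(1) ll 3 by (simp add: algebra_simps)
      then have "l = a \<or> l = q" by simp
      then show ?thesis using *[of 1 0] *[of 0 1] 3 by auto
    qed
  qed
  moreover have S: "S \<subseteq> {c * l, c / l}"
  proof
    fix y assume "y \<in> S"
    then obtain z and v :: "complex^2" where v: "y = cmod z" "v \<noteq> 0"
      "c * a * v $ 1 + c * b * v $ 2 = z * v $ 1" "c * p * v $ 1 + c * q * v $ 2 = z * v $ 2"
      unfolding S_def using eig by auto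
    define D where "D = (c * a - z) * (c * q - z) - c * b * (c * p)"
    have "D * v $ 1 = 0" using v(3,4) unfolding D_def of_real_mult by algebra
    moreover have "D * v $ 2 = 0" using v(3,4) unfolding D_def of_real_mult by algebra
    moreover have "v $ 1 \<noteq> 0 \<or> v $ 2 \<noteq> 0" using v(2) by (auto simp: vec_eq_iff forall_2)
    ultimately have "D = 0" by auto
    have "D = z * z - of_real (c * (a + q)) * z + of_real (c * c * (a * q - b * p))"
      unfolding D_def by (simp add: algebra_simps)
    also have "\<dots> = (z - of_real (c * l)) * (z - of_real (c / l))"
      unfolding dd using l(1) c by (simp add: field_simps)
    finally have "z = of_real (c * l) \<or> z = of_real (c / l)" using \<open>D = 0\<close> by simp
    then show "y \<in> {c * l, c / l}" using v(1) c l(1) by (auto simp: norm_mult norm_divide)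
  qed
  moreover have "c / l \<le> c * l" using l(1) c mult_mono[of 1 l 1 l] by (simp add: field_simps)
  ultimately have "Max S = c * l"
    by (intro Max_eqI) (auto intro: finite_subset)
  then show ?thesis unfolding spectral_radius_def S_def l_def .
qed

lemma tr_le_onorm: "c \<ge> 0 \<Longrightarrow> c * tr X \<le> 2 * onorm ((*v) (c *\<^sub>R to_mat X))"
proof -
  assume c: "c \<ge> 0"
  have "\<bar>(c *\<^sub>R to_mat X) $ 1 $ 1\<bar> \<le> onorm ((*v) (c *\<^sub>R to_mat X))"
    and "\<bar>(c *\<^sub>R to_mat X) $ 2 $ 2\<bar> \<le> onorm ((*v) (c *\<^sub>R to_mat X))"
    by (rule matrix_component_le_onorm)+
  then show ?thesis by (simp add: to_mat_def tr_def algebra_simps)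
qed

lemma spectral_radius_word:
  assumes "\<alpha> > 0"
  shows "spectral_radius (mat_prod (map (letter \<alpha>) w)) = \<alpha> ^ count_list w False * rho w"
  unfolding mat_prod_letters using assms by (intro spectral_radius_to_mat tr_mat_of_ge_2) auto

text \<open>
  Along the lengths of the powers of \<open>w\<close> the norm is at least half the trace, hence at least half
  of the power of the spectral radius; the factor \<open>1 / 2\<close> disappears when roots are taken.
\<close>
lemma joint_spectral_radius_ge:
  assumes \<alpha>: "\<alpha> > 0" and w: "w \<noteq> []"
  shows "ereal (root (length w) (\<alpha> ^ count_list w False * rho w)) \<le> joint_spectral_radius (A_alpha \<alpha>)"
proof -
  define m where "m = length w"
  have m: "m > 0" using w by (simp add: m_def)
  define x where "x = \<alpha> ^ count_list w False * rho w"
  have x: "x > 0" unfolding x_def using \<alpha> rho_ge_1[of w] by (intro mult_pos_pos) auto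
  define R where "R n = {root n (onorm ((*v) (mat_prod As))) | As. length As = n \<and> set As \<subseteq> A_alpha \<alpha>}" for n
  define s where "s k = Suc k * m" for k
  have s: "strict_mono s" unfolding s_def using m by (intro strict_monoI) simp
  have ge: "root (s k) (1 / 2) * root m x \<le> Max (R (s k))" for k
  proof -
    define u where "u = concat (replicate (Suc k) w)"
    have len: "length u = s k" by (simp add: u_def length_concat sum_list_replicate s_def m_def)
    have "finite {As. set As \<subseteq> A_alpha \<alpha> \<and> length As = s k}"
      by (intro finite_lists_length_eq) (simp add: A_alpha_eq)
    moreover have "R (s k) = (\<lambda>As. root (s k) (onorm ((*v) (mat_prod As)))) ` {As. set As \<subseteq> A_alpha \<alpha> \<and> length As = s k}"
      unfolding R_def by auto
    ultimately have fin: "finite (R (s k))" by simp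
    have mem: "root (s k) (onorm ((*v) (mat_prod (map (letter \<alpha>) u)))) \<in> R (s k)"
      unfolding R_def using len by (intro CollectI exI[of _ "map (letter \<alpha>) u"]) (auto simp: A_alpha_eq)
    have "root (s k) (1 / 2) * root m x = root (s k) (1 / 2) * root m (root (Suc k) (x ^ Suc k))"
      using x by (subst real_root_power_cancel) auto
    also have "\<dots> = root (s k) (1 / 2) * root (s k) (x ^ Suc k)"
      by (simp only: real_root_mult_exp[symmetric] s_def mult.commute)
    also have "\<dots> = root (s k) (x ^ Suc k / 2)"
      by (simp only: real_root_mult[symmetric]) simp
    also have "\<dots> \<le> root (s k) (onorm ((*v) (mat_prod (map (letter \<alpha>) u))))"
    proof -
      have "x ^ Suc k \<le> \<alpha> ^ count_list u False * tr (mat_of u)"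
      proof -
        have "\<alpha> ^ (Suc k * count_list w False) = (\<alpha> ^ count_list w False) ^ Suc k"
          by (metis power_mult mult.commute)
        then show ?thesis
          unfolding x_def u_def word_concat_replicate count_concat_replicate power_mult_distrib
          using \<alpha> tr_power_ge[of w "Suc k"] by (simp add: mult_left_mono del: power_Suc mult_Suc)
      qed
      also have "\<dots> \<le> 2 * onorm ((*v) (mat_prod (map (letter \<alpha>) u)))"
        unfolding mat_prod_letters using \<alpha> by (intro tr_le_onorm) simp
      finally show ?thesis using m by (intro real_root_le_mono) (auto simp: s_def)
    qed
    also have "\<dots> \<le> Max (R (s k))" using fin mem by (rule Max_ge)
    finally show ?thesis .
  qed
  have "(\<lambda>k. root (s k) (1 / 2)) \<longlonglongrightarrow> 1"
    using LIMSEQ_subseq_LIMSEQ[OF LIMSEQ_root_const[of "1/2"] s] by (simp add: o_def)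
  from tendsto_mult[OF this tendsto_const[of "root m x"]]
  have "(\<lambda>k. ereal (root (s k) (1 / 2) * root m x)) \<longlonglongrightarrow> ereal (root m x)" by simp
  then have "ereal (root m x) = limsup (\<lambda>k. ereal (root (s k) (1 / 2) * root m x))"
    by (rule lim_imp_Limsup[OF sequentially_bot, symmetric])
  also have "\<dots> \<le> limsup ((\<lambda>n. ereal (Max (R n))) \<circ> s)"
    using ge by (intro Limsup_mono) auto
  also have "\<dots> \<le> limsup (\<lambda>n. ereal (Max (R n)))"
    by (rule limsup_subseq_mono[OF s])
  also have "\<dots> = joint_spectral_radius (A_alpha \<alpha>)"
    unfolding joint_spectral_radius_def R_def ..
  finally show ?thesis unfolding x_def m_def .
qed

section \<open>Growth of the trace sequence\<close>

abbreviation T :: "nat \<Rightarrow> real" where "T n \<equiv> of_int (tau n)"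

lemma tau_rec: "T (Suc (Suc (Suc n))) = T (Suc (Suc n)) * T (Suc n) - T n"
  by simp

lemma tau_basic: "1 \<le> tau n \<and> tau n \<le> tau (Suc n) \<and> 2 \<le> tau (Suc n) \<and> tau (Suc n) \<le> tau (Suc (Suc n))"
proof (induction n)
  case (Suc n)
  have "tau (Suc (Suc n)) * 2 \<le> tau (Suc (Suc n)) * tau (Suc n)"
    using Suc by (intro mult_left_mono) auto
  with Suc show ?case unfolding tau.simps(4) by linarith
qed simp

lemma T_facts: "1 \<le> T n" "T n \<le> T (Suc n)" "2 \<le> T (Suc n)"
  using tau_basic[of n] by linarith+

text \<open>
  Let \<open>X\<^sub>k\<close> be the product of the Fibonacci word with index \<open>k\<close>. Then \<open>X\<^sub>k\<^sub>+\<^sub>3\<close> is a rotation of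
  \<open>X\<^sub>k\<^sub>+\<^sub>1\<^sup>2 X\<^sub>k\<close>, where Cayley and Hamilton give the recursion of \<open>\<tau>\<close>. The index is shifted by
  one since the words start with the traces \<open>\<tau>\<^sub>1 = \<tau>\<^sub>2 = 2\<close>.
\<close>
lemma tr_fmat: "tr (fmat k) = T (Suc k)"
proof -
  have tr3: "tr (fmat (Suc (Suc (Suc k)))) = tr (fmat (Suc (Suc k))) * tr (fmat (Suc k)) - tr (fmat k)" for k
  proof -
    have "tr (fmat (Suc (Suc (Suc k)))) = tr (fmat (Suc k) * fmat (Suc k) * fmat k)"
      by (simp add: mult.assoc) (subst tr_mult_commute, simp add: mult.assoc)
    also have "\<dots> = tr (fmat (Suc k)) * tr (fmat (Suc k) * fmat k) - tr (fmat k)"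
      by (rule cayley_hamilton_tr) simp
    finally show ?thesis by simp
  qed
  have "tr (fmat k) = T (Suc k) \<and> tr (fmat (Suc k)) = T (Suc (Suc k)) \<and> tr (fmat (Suc (Suc k))) = T (Suc (Suc (Suc k)))"
  proof (induction k)
    case 0
    show ?case by (simp add: tr_def mat_A_def mat_B_def)
  next
    case (Suc k)
    then show ?case using tr3[of k] tau_rec[of "Suc k"] by metis
  qed
  then show ?thesis ..
qed

lemma tau_values: "tau 5 = 10" "tau 6 = 37" "tau 7 = 366" "tau 8 = 13532"
  by code_simp+

text \<open>
  The growth is in fact doubly exponential. A ratio of \<open>9\<close>, valid from \<open>\<tau>\<^sub>6 = 37\<close> on because then
  \<open>\<tau>\<^sub>n\<^sub>-\<^sub>1 \<ge> 10\<close>, is enough: it beats the product of two Fibonacci numbers, which is at most of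
  order \<open>4\<^sup>n\<close>.
\<close>
lemma T_growth: "37 * 9 ^ n \<le> 9 ^ 6 * T n"
proof -
  have ge: "37 * 9 ^ j \<le> T (6 + j)" for j
  proof (induction j)
    case 0
    show ?case by (simp add: tau_values)
  next
    case (Suc j)
    have mono: "10 \<le> T (5 + j)" for j
    proof (induction j)
      case (Suc j)
      then show ?case using T_facts(2)[of "5 + j"] by simp
    qed (simp add: tau_values)
    have "T (6 + Suc j) = T (6 + j) * T (5 + j) - T (4 + j)"
      using tau_rec[of "4 + j"] by (simp add: eval_nat_numeral)
    moreover have "T (4 + j) \<le> T (6 + j)"
      using T_facts(2)[of "4 + j"] T_facts(2)[of "5 + j"] by (simp add: eval_nat_numeral)
    moreover have "T (6 + j) * 10 \<le> T (6 + j) * T (5 + j)"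
      using mono T_facts(1)[of "6 + j"] by (intro mult_left_mono) auto
    ultimately have "9 * T (6 + j) \<le> T (6 + Suc j)" by linarith
    with Suc show ?case by simp
  qed
  consider j where "n = 6 + j" | "n = 0" | "n = 1" | "n = 2" | "n = 3" | "n = 4" | "n = 5"
  proof -
    have "n = 6 + (n - 6) \<or> n \<le> 5" by linarith
    moreover have "n \<le> 5 \<Longrightarrow> n = 0 \<or> n = 1 \<or> n = 2 \<or> n = 3 \<or> n = 4 \<or> n = 5" by linarith
    ultimately show ?thesis using that by blast
  qed
  then show ?thesis
  proof cases
    case 1
    with ge[of j] show ?thesis by (simp add: power_add)
  qed (simp_all add: eval_nat_numeral)
qed

lemma fib_le_power: "real (fib n) \<le> 2 ^ n"
proof (induction n rule: fib.induct)
  case (3 n)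
  have "real (fib (Suc (Suc n))) = real (fib (Suc n)) + real (fib n)" by simp
  also have "\<dots> \<le> 2 ^ Suc n + 2 ^ n" using 3 by linarith
  also have "\<dots> \<le> 2 ^ Suc (Suc n)" by simp
  finally show ?case .
qed auto

section \<open>Convergence of the product\<close>

definition log_alpha_seq :: "nat \<Rightarrow> real" where
  "log_alpha_seq n = (-1) ^ n * (real (fib (Suc n)) * ln (T n) - real (fib n) * ln (T (Suc n)))"

lemma powi_eq_exp: "x > 0 \<Longrightarrow> x powi k = exp (of_int k * ln x)" for x :: real
  using exp_power_int[of "ln x" k] by simp

lemma T_pos: "0 < T n"
  using T_facts(1)[of n] by linarith

lemma alpha_seq_eq: "alpha_seq n = exp (log_alpha_seq n)"
proof -
  have "0 < T n ^ fib (n + 1) / T (n + 1) ^ fib n" using T_pos by simp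
  moreover have "ln (T n ^ fib (n + 1) / T (n + 1) ^ fib n) = real (fib (Suc n)) * ln (T n) - real (fib n) * ln (T (Suc n))"
    using T_pos[of n] T_pos[of "Suc n"] by (simp add: ln_div ln_realpow)
  ultimately show ?thesis
    unfolding alpha_seq_def log_alpha_seq_def by (subst powi_eq_exp) auto
qed

definition log_factor :: "nat \<Rightarrow> real" where
  "log_factor i = log_alpha_seq (Suc (Suc i)) - log_alpha_seq (Suc i)"

lemma log_factor_eq:
  "log_factor i = (-1) ^ Suc i * (real (fib (Suc (Suc i))) * ln (1 - T i / (T (Suc i) * T (Suc (Suc i)))))"
proof -
  have p: "0 < T (Suc i)" "0 < T (Suc (Suc i))" "0 < T (Suc (Suc (Suc i)))" using T_pos by blast+
  have "1 - T i / (T (Suc i) * T (Suc (Suc i))) = T (Suc (Suc (Suc i))) / (T (Suc i) * T (Suc (Suc i)))"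
    using p(1,2) unfolding tau_rec by (simp add: field_simps)
  then have "ln (1 - T i / (T (Suc i) * T (Suc (Suc i)))) = ln (T (Suc (Suc (Suc i)))) - ln (T (Suc i)) - ln (T (Suc (Suc i)))"
    using p by (simp only: ln_div ln_mult_pos mult_pos_pos) simp
  then show ?thesis
    unfolding log_factor_def log_alpha_seq_def by (simp only: fib.simps of_nat_add) (simp add: algebra_simps)
qed

lemma delta_bounds:
  "0 < T i / (T (Suc i) * T (Suc (Suc i)))"
  "T i / (T (Suc i) * T (Suc (Suc i))) \<le> 1 / T (Suc (Suc i))" "1 / T (Suc (Suc i)) \<le> 1 / 2"
proof -
  have p: "0 < T i" "0 < T (Suc i)" "0 < T (Suc (Suc i))" using T_pos by blast+
  then show "0 < T i / (T (Suc i) * T (Suc (Suc i)))" by simp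
  show "T i / (T (Suc i) * T (Suc (Suc i))) \<le> 1 / T (Suc (Suc i))"
    using p T_facts(2)[of i] by (simp add: field_simps del: tau.simps)
  show "1 / T (Suc (Suc i)) \<le> 1 / 2"
    using T_facts(3)[of "Suc i"] p by (simp add: field_simps del: tau.simps)
qed

lemma alpha_factor_eq: "alpha_factor (Suc i) = exp (log_factor i)"
proof -
  have "0 < 1 - T i / (T (Suc i) * T (Suc (Suc i)))" using delta_bounds[of i] by linarith
  then show ?thesis
    unfolding alpha_factor_def log_factor_eq by (simp add: powi_eq_exp del: tau.simps fib.simps)
qed

lemma log_factor_bound: "\<bar>log_factor i\<bar> \<le> 2 * 9 ^ 6 / 37 * (2 / 9) ^ (i + 2)"
proof -
  define x where "x = T i / (T (Suc i) * T (Suc (Suc i)))"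
  have x: "0 < x" "x \<le> 1 / T (Suc (Suc i))" "x \<le> 1 / 2"
    using delta_bounds[of i] unfolding x_def by linarith+
  have "ln (1 / (1 - x)) \<le> 1 / (1 - x) - 1" using x by (intro ln_le_minus_one) auto
  also have "\<dots> \<le> 2 * x"
  proof -
    have "x * (1 - 2 * x) \<ge> 0" using x by simp
    then show ?thesis using x by (simp add: field_simps)
  qed
  finally have "- ln (1 - x) \<le> 2 * x" using x by (simp add: ln_div)
  moreover have "ln (1 - x) \<le> 0" using x by simp
  ultimately have "\<bar>ln (1 - x)\<bar> \<le> 2 * x" by simp
  also have "\<dots> \<le> 2 * (9 ^ 6 / (37 * 9 ^ (i + 2)))"
  proof -
    have "1 / T (i + 2) \<le> 9 ^ 6 / (37 * 9 ^ (i + 2))"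
      using T_growth[of "i + 2"] T_pos[of "i + 2"] by (simp add: field_simps del: tau.simps)
    then show ?thesis using x(2) by (simp del: tau.simps)
  qed
  finally have "real (fib (i + 2)) * \<bar>ln (1 - x)\<bar> \<le> 2 ^ (i + 2) * (2 * (9 ^ 6 / (37 * 9 ^ (i + 2))))"
    by (intro mult_mono fib_le_power) auto
  also have "\<dots> = 2 * 9 ^ 6 / 37 * (2 / 9) ^ (i + 2)" by (simp add: power_divide)
  finally show ?thesis
    unfolding log_factor_eq x_def by (simp add: abs_mult power_abs del: tau.simps fib.simps)
qed

lemma summable_log_factor: "summable (\<lambda>i. \<bar>log_factor i\<bar>)"
proof (rule summable_comparison_test)
  show "\<exists>N. \<forall>n\<ge>N. norm \<bar>log_factor n\<bar> \<le> 2 * 9 ^ 6 / 37 * (2 / 9) ^ 2 * (2 / 9) ^ n"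
    using log_factor_bound by (intro exI[of _ 0]) (simp add: power_add power2_eq_square mult_ac)
  show "summable (\<lambda>n. 2 * 9 ^ 6 / 37 * (2 / 9) ^ 2 * (2 / 9) ^ n :: real)"
    by (intro summable_mult summable_geometric) simp
qed

definition log_alpha :: real where "log_alpha = suminf log_factor"

lemma log_factor_sums: "log_factor sums log_alpha"
  unfolding log_alpha_def using summable_log_factor by (metis summable_rabs_cancel summable_sums)

lemma sum_log_factor: "(\<Sum>i<n. log_factor i) = log_alpha_seq (Suc n)"
proof (induction n)
  case 0
  show ?case by (simp add: log_alpha_seq_def)
next
  case (Suc n)
  then show ?case by (simp add: log_factor_def)
qed

lemma alpha_seq_tendsto: "alpha_seq \<longlonglongrightarrow> exp log_alpha"
proof -
  have "(\<lambda>n. log_alpha_seq (Suc n)) \<longlonglongrightarrow> log_alpha"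
    using log_factor_sums by (simp add: sums_def sum_log_factor)
  then have "log_alpha_seq \<longlonglongrightarrow> log_alpha" by (rule LIMSEQ_imp_Suc)
  then have "(\<lambda>n. exp (log_alpha_seq n)) \<longlonglongrightarrow> exp log_alpha" by (rule tendsto_exp)
  then show ?thesis by (simp add: alpha_seq_eq[abs_def])
qed

lemma alpha_star_eq: "alpha_star = exp log_alpha"
  unfolding alpha_star_def using alpha_seq_tendsto by (rule limI)

text \<open>
  The logarithms of the factors are absolutely summable, so their sum may be rearranged.
\<close>
lemma has_prod_rearranged:
  assumes "bij \<pi>"
  shows "((\<lambda>n. alpha_factor (Suc n)) \<circ> \<pi>) has_prod alpha_star"
proof -
  have "(log_factor has_sum log_alpha) UNIV"
    using norm_summable_imp_has_sum[of log_factor] summable_log_factor log_factor_sums by simp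
  then have "((\<lambda>i. log_factor (\<pi> i)) has_sum log_alpha) UNIV"
    using has_sum_reindex_bij_betw[OF assms] by blast
  then have "(\<lambda>i. log_factor (\<pi> i)) sums log_alpha" by (rule has_sum_imp_sums)
  from sums_imp_has_prod_exp[OF this]
  show ?thesis by (simp add: has_prod_def o_def alpha_factor_eq alpha_star_eq)
qed

lemma log_alpha_approx: "\<bar>log_alpha - log_alpha_seq (Suc n)\<bar> \<le> 18 * 9 ^ 6 / 259 * (2 / 9) ^ (n + 2)"
proof -
  have "(\<lambda>i. log_factor (i + n)) sums (log_alpha - log_alpha_seq (Suc n))"
    using sums_split_initial_segment[OF log_factor_sums, of n] by (simp add: sum_log_factor)
  then have eq: "log_alpha - log_alpha_seq (Suc n) = (\<Sum>i. log_factor (i + n))" by (simp add: sums_unique)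
  have g: "(\<lambda>i. 2 * 9 ^ 6 / 37 * (2 / 9) ^ (n + 2) * (2 / 9) ^ i) sums
      (2 * 9 ^ 6 / 37 * (2 / 9) ^ (n + 2) * (1 / (1 - 2 / 9)) :: real)"
    by (intro sums_mult geometric_sums) simp
  have le: "norm (log_factor (i + n)) \<le> 2 * 9 ^ 6 / 37 * (2 / 9) ^ (n + 2) * (2 / 9) ^ i" for i
    using log_factor_bound[of "i + n"] by (simp add: power_add mult_ac)
  have "norm (\<Sum>i. log_factor (i + n)) \<le> (\<Sum>i. 2 * 9 ^ 6 / 37 * (2 / 9) ^ (n + 2) * (2 / 9) ^ i)"
    using g le by (intro norm_suminf_le) (auto simp: sums_iff)
  also have "\<dots> = 2 * 9 ^ 6 / 37 * (2 / 9) ^ (n + 2) * (1 / (1 - 2 / 9))"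
    using g by (rule sums_unique[symmetric])
  finally show ?thesis unfolding eq by simp
qed

text \<open>
  The member of the sequence with index \<open>7\<close> is about \<open>0.7493\<close>, and the tail bound from there on is
  below \<open>0.22\<close>.
\<close>
lemma alpha_star_le_1: "alpha_star \<le> 1"
proof -
  have "log_alpha \<le> log_alpha_seq 7 + 18 * 9 ^ 6 / 259 * (2 / 9) ^ 8"
  proof -
    have "log_alpha \<le> log_alpha_seq (Suc 6) + 18 * 9 ^ 6 / 259 * (2 / 9) ^ (6 + 2)"
      using log_alpha_approx[of 6] by linarith
    then show ?thesis by simp
  qed
  also have "log_alpha_seq 7 \<le> alpha_seq 7 - 1"
    using exp_ge_add_one_self[of "log_alpha_seq 7"] unfolding alpha_seq_eq by linarith
  also have "alpha_seq 7 = 13532 ^ 13 / 366 ^ 21"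
  proof -
    have "fib 7 = 13" "fib 8 = 21" by code_simp+
    then show ?thesis by (simp add: alpha_seq_def tau_values power_int_minus)
  qed
  finally have "log_alpha \<le> 0" by (simp add: power_divide)
  then show ?thesis by (simp add: alpha_star_eq)
qed

section \<open>Slopes between consecutive Fibonacci words\<close>

text \<open>
  The Fricke invariant \<open>x\<^sup>2 + y\<^sup>2 + z\<^sup>2 - xyz - 2\<close> of a pair of matrices is the trace of their
  group commutator, which is \<open>3\<close> for \<open>A\<close> and \<open>B\<close>. The recursion of \<open>\<tau>\<close> passes to the other root of
  this quadratic equation.
\<close>
lemma tau_markov: "T k ^ 2 + T (Suc k) ^ 2 + T (Suc (Suc k)) ^ 2 - T k * T (Suc k) * T (Suc (Suc k)) = 5"
proof (induction k)
  case 0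
  show ?case by simp
next
  case (Suc k)
  then show ?case unfolding tau_rec by (simp add: algebra_simps power2_eq_square del: tau.simps)
qed

definition lrho_fib :: "nat \<Rightarrow> real" where "lrho_fib k = lrho (fword k)"

text \<open>
  The trace is \<open>l + 1 / l\<close>, so replacing spectral radii by traces costs very little.
\<close>
lemma lrho_fib_approx: "0 \<le> ln (T (Suc k)) - lrho_fib k" "ln (T (Suc k)) - lrho_fib k \<le> 2 / T (Suc k)"
proof -
  define l where "l = lam (T (Suc k))"
  have l: "1 \<le> l" "l + 1 / l = T (Suc k)" "l \<le> T (Suc k)" "T (Suc k) \<le> 2 * l"
    using lam_facts[of "T (Suc k)"] T_facts(3)[of k] by (auto simp: l_def)
  have qk: "lrho_fib k = ln l" by (simp add: lrho_fib_def lrho_def tr_fmat l_def)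
  show "0 \<le> ln (T (Suc k)) - lrho_fib k" unfolding qk using l by simp
  have "ln (T (Suc k)) - ln l = ln (T (Suc k) / l)" using l by (subst ln_div) auto
  also have "\<dots> \<le> T (Suc k) / l - 1" using l by (intro ln_le_minus_one) (auto intro: divide_pos_pos)
  also have "\<dots> = 1 / (l * l)" unfolding l(2)[symmetric] using l(1) by (simp add: field_simps)
  also have "\<dots> \<le> 1 / l" using l(1) by (simp add: field_simps)
  also have "\<dots> \<le> 2 / T (Suc k)" using l by (simp add: field_simps)
  finally show "ln (T (Suc k)) - lrho_fib k \<le> 2 / T (Suc k)" by (simp add: qk)
qed

text \<open>
  The distance from \<open>- ln \<alpha>\<^sub>*\<close> of the chord slope between two consecutive Fibonacci words; the
  factor \<open>(-1)\<^sup>m\<close> comes from the determinant of their letter counts. With traces in place of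
  spectral radii the slope would be \<open>- ln (alpha_seq (m + 1))\<close>.
\<close>
definition slope_error :: "nat \<Rightarrow> real" where
  "slope_error m = \<bar>(-1) ^ m * (real (fib (Suc m)) * lrho_fib (Suc m) - real (fib (Suc (Suc m))) * lrho_fib m) - log_alpha\<bar>"

text \<open>
  Only the geometric rate matters: it has to be below \<open>1 / 2\<close>, since Fibonacci numbers grow slower
  than \<open>2\<^sup>m\<close>.
\<close>
lemma slope_error_bound: "slope_error m \<le> 10 ^ 6 * (2 / 9) ^ m"
proof -
  define u where "u k = ln (T (Suc k)) - lrho_fib k" for k
  have u: "0 \<le> u k" "u k \<le> 2 / T (Suc k)" for k using lrho_fib_approx by (auto simp: u_def)
  have fu: "real (fib f) * u k \<le> 2 ^ f * (2 * 9 ^ 6 / (37 * 9 ^ Suc k))" for f k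
  proof -
    have "2 / T (Suc k) \<le> 2 * 9 ^ 6 / (37 * 9 ^ Suc k)"
      using T_growth[of "Suc k"] T_pos[of "Suc k"] by (simp add: field_simps del: tau.simps)
    then show ?thesis using u[of k] fib_le_power[of f] by (intro mult_mono) auto
  qed
  define a where "a = real (fib (Suc m)) * u (Suc m)"
  define b where "b = real (fib (Suc (Suc m))) * u m"
  have "(-1) ^ m * (real (fib (Suc m)) * lrho_fib (Suc m) - real (fib (Suc (Suc m))) * lrho_fib m)
      = log_alpha_seq (Suc m) - (-1) ^ m * (a - b)"
    unfolding log_alpha_seq_def a_def b_def u_def by (simp add: algebra_simps del: tau.simps fib.simps)
  then have "slope_error m \<le> \<bar>log_alpha - log_alpha_seq (Suc m)\<bar> + \<bar>(-1) ^ m * (a - b)\<bar>"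
    unfolding slope_error_def by linarith
  also have "\<bar>(-1) ^ m * (a - b)\<bar> = \<bar>a - b\<bar>" by (simp add: abs_mult power_abs)
  also have "\<bar>a - b\<bar> \<le> a + b" using u unfolding a_def b_def by (simp add: abs_le_iff add_increasing add_increasing2)
  also have "\<dots> \<le> 2 ^ Suc m * (2 * 9 ^ 6 / (37 * 9 ^ Suc (Suc m))) + 2 ^ Suc (Suc m) * (2 * 9 ^ 6 / (37 * 9 ^ Suc m))"
    unfolding a_def b_def by (intro add_mono fu)
  also have "\<dots> = (4 * 9 ^ 6 / (37 * 81) + 8 * 9 ^ 6 / (37 * 9)) * (2 / 9) ^ m"
    by (simp add: power_divide field_simps)
  finally have "slope_error m \<le> 18 * 9 ^ 6 / 259 * (2 / 9) ^ (m + 2) + (4 * 9 ^ 6 / (37 * 81) + 8 * 9 ^ 6 / (37 * 9)) * (2 / 9) ^ m"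
    using log_alpha_approx[of m] by linarith
  also have "\<dots> = (18 * 9 ^ 6 / 259 * (2 / 9) ^ 2 + (4 * 9 ^ 6 / (37 * 81) + 8 * 9 ^ 6 / (37 * 9))) * (2 / 9) ^ m"
    by (simp add: power_add power2_eq_square algebra_simps)
  also have "\<dots> \<le> 10 ^ 6 * (2 / 9) ^ m" by (intro mult_right_mono) (auto simp: power2_eq_square)
  finally show ?thesis .
qed

lemma fib_slope_error_tendsto_0: "(\<lambda>m. real (fib (Suc m)) * slope_error m) \<longlonglongrightarrow> 0"
proof (rule tendsto_sandwich)
  show "\<forall>\<^sub>F m in sequentially. 0 \<le> real (fib (Suc m)) * slope_error m" by (simp add: slope_error_def)
  have "real (fib (Suc m)) * slope_error m \<le> 2 * 10 ^ 6 * (4 / 9) ^ m" for m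
  proof -
    have "real (fib (Suc m)) * slope_error m \<le> 2 ^ Suc m * (10 ^ 6 * (2 / 9) ^ m)"
      using fib_le_power[of "Suc m"] slope_error_bound[of m] by (intro mult_mono) (auto simp: slope_error_def)
    also have "\<dots> = 2 * 10 ^ 6 * (4 / 9) ^ m"
      using power_mult_distrib[of 2 "2 / 9 :: real" m] by simp
    finally show ?thesis .
  qed
  then show "\<forall>\<^sub>F m in sequentially. real (fib (Suc m)) * slope_error m \<le> 2 * 10 ^ 6 * (4 / 9) ^ m" by simp
  have "(\<lambda>m. 2 * 10 ^ 6 * (4 / 9) ^ m :: real) \<longlonglongrightarrow> 2 * 10 ^ 6 * 0"
    by (intro tendsto_mult tendsto_const LIMSEQ_realpow_zero) auto
  then show "(\<lambda>m. 2 * 10 ^ 6 * (4 / 9) ^ m :: real) \<longlonglongrightarrow> 0" by simp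
qed simp

lemma plus_inverse_less_imp:
  assumes "1 \<le> l" "1 \<le> u" "u + 1 / u < l + 1 / l"
  shows "u < (l :: real)"
proof (rule ccontr)
  assume "\<not> u < l"
  then have "0 \<le> (u - l) * (1 - 1 / (u * l))"
    using assms mult_mono[of 1 u 1 l] by (intro mult_nonneg_nonneg) auto
  also have "\<dots> = (u + 1 / u) - (l + 1 / l)" using assms by (simp add: field_simps)
  finally show False using assms by simp
qed

text \<open>
  Let \<open>l, m\<close> be the spectral radii of the two words. The traces \<open>x, z\<close> of the words and \<open>t\<close> of the
  concatenation satisfy the same Markov type equation as \<open>\<tau>\<close>. It factors as \<open>(t - P)(t - Q) = 1\<close>
  with \<open>P = l m + 1 / (l m)\<close> and \<open>Q = l / m + m / l\<close>, and since \<open>t \<ge> z \<ge> Q\<close>, both factors are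
  positive. Thus \<open>t > P\<close>, which means \<open>lam t > l m\<close>.
\<close>
lemma lrho_concat_strict: "lrho_fib k + lrho_fib (Suc (Suc k)) < lrho (fword k @ fword (Suc (Suc k)))"
proof -
  define x y z where "x = T (Suc k)" and "y = T (Suc (Suc k))" and "z = T (Suc (Suc (Suc k)))"
  define l m where "l = lam x" and "m = lam z"
  have xyz: "2 \<le> x" "x \<le> y" "y \<le> z" unfolding x_def y_def z_def using T_facts by blast+
  have l: "1 \<le> l" "l + 1 / l = x" and m: "1 \<le> m" "m + 1 / m = z"
    using lam_facts xyz unfolding l_def m_def by auto
  have lm: "l \<le> m"
    unfolding l_def m_def lam_def using xyz power_mono[of x z 2] by (auto intro!: divide_right_mono add_mono real_sqrt_le_mono)
  define t where "t = tr (mat_of (fword k @ fword (Suc (Suc k))))"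
  have t: "t = x * z - y"
  proof -
    have "t = tr (fmat k * fmat (Suc k) * fmat k)" by (simp add: t_def mult.assoc)
    also have "\<dots> = tr (fmat k * fmat k * fmat (Suc k))"
      by (subst tr_mult_commute) (simp add: mult.assoc)
    also have "\<dots> = tr (fmat k) * tr (fmat k * fmat (Suc k)) - tr (fmat (Suc k))"
      by (rule cayley_hamilton_tr) simp
    also have "tr (fmat k * fmat (Suc k)) = tr (fmat (Suc (Suc k)))"
      by (subst tr_mult_commute) simp
    finally show ?thesis by (simp only: tr_fmat x_def y_def z_def)
  qed
  define P where "P = l * m + 1 / (l * m)"
  define Q where "Q = l / m + m / l"
  have PQ: "P + Q = x * z" "P * Q = x * x + z * z - 4"
  proof -
    define l' m' where "l' = 1 / l" and "m' = 1 / m"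
    have u: "l * l' = 1" "m * m' = 1" using l(1) m(1) by (simp_all add: l'_def m'_def)
    have e: "P = l * m + l' * m'" "Q = l * m' + m * l'" "x = l + l'" "z = m + m'"
      using l(2) m(2) by (simp_all add: P_def Q_def l'_def m'_def)
    show "P + Q = x * z" unfolding e by (simp add: algebra_simps)
    show "P * Q = x * x + z * z - 4" unfolding e using u by algebra
  qed
  have "x * x + y * y + z * z - x * y * z = 5"
    using tau_markov[of "Suc k"] unfolding x_def y_def z_def by (simp add: power2_eq_square del: tau.simps)
  moreover have "(t - P) * (t - Q) = t * t - t * (P + Q) + P * Q" by (simp add: algebra_simps)
  ultimately have one: "(t - P) * (t - Q) = 1"
    unfolding PQ t by (simp add: algebra_simps)
  have "1 * l \<le> m * m" using l(1) m(1) lm by (intro mult_mono) auto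
  then have "0 \<le> (l - 1) * (m * m - l) / (l * m)" using l(1) m(1) by simp
  also have "\<dots> = (m + 1 / m) - (l / m + m / l)" using l(1) m(1) by (simp add: field_simps)
  finally have "Q \<le> z" unfolding Q_def m(2) by simp
  also have "z \<le> t" unfolding t using xyz mult_right_mono[of 2 x z] by linarith
  finally have "Q \<le> t" .
  moreover have "t \<noteq> Q" using one by auto
  moreover have "0 < (t - P) * (t - Q)" using one by simp
  ultimately have "P < t" by (simp add: zero_less_mult_iff)
  have t2: "2 \<le> t" unfolding t_def by (rule tr_mat_of_ge_2)
  have lm1: "1 \<le> l * m" using mult_mono[of 1 l 1 m] l(1) m(1) by simp
  have "l * m < lam t"
    by (rule plus_inverse_less_imp[OF lam_ge_1[OF t2] lm1])
      (use \<open>P < t\<close> lam_plus_inverse[OF t2] in \<open>simp only: P_def\<close>)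
  then have "ln (l * m) < ln (lam t)" using l(1) m(1) lam_ge_1[OF t2] by (subst ln_less_cancel_iff) auto
  moreover have "ln (l * m) = lrho_fib k + lrho_fib (Suc (Suc k))"
  proof -
    have "lrho_fib k = ln l" "lrho_fib (Suc (Suc k)) = ln m"
      unfolding lrho_fib_def lrho_def tr_fmat l_def m_def x_def z_def by (rule refl)+
    then show ?thesis using l(1) m(1) by (simp add: ln_mult_pos)
  qed
  ultimately show ?thesis unfolding lrho_def t_def by simp
qed

section \<open>No finite word attains the joint spectral radius\<close>

text \<open>
  Two neighbours of the same sign force that sign from then on. If signs alternated forever, the
  absolute values would decrease forever. This replaces the irrationality of the golden ratio:
  applied to the letter counts of a word, it says on which side of the golden frequency the word
  lies.
\<close>
lemma fib_like_eventually_signed: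
  fixes D :: "nat \<Rightarrow> int"
  assumes rec: "\<And>m. D (Suc (Suc m)) = D (Suc m) + D m" and nz: "D 0 \<noteq> 0 \<or> D 1 \<noteq> 0"
  shows "\<exists>e N. e \<in> {1, -1} \<and> (\<forall>m\<ge>N. 0 < e * D m)"
proof -
  have nz': "D m \<noteq> 0 \<or> D (Suc m) \<noteq> 0" for m
  proof (induction m)
    case (Suc m)
    then show ?case using rec[of m] by auto
  qed (use nz in auto)
  have pos: "\<exists>N. \<forall>m\<ge>N. 0 < e * D m" if "0 \<le> e * D m" "0 \<le> e * D (Suc m)" "e \<in> {1, -1}" for e m
  proof -
    have *: "0 < e * D (m + 2 + k) \<and> 0 < e * D (Suc (m + 2 + k))" for k
    proof (induction k)
      case 0
      have "0 < e * D m \<or> 0 < e * D (Suc m)" using nz'[of m] that by auto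
      moreover have "D (m + 2) = D (Suc m) + D m" "D (Suc (m + 2)) = D (m + 2) + D (Suc m)"
        using rec[of m] rec[of "Suc m"] by simp_all
      ultimately show ?case using that by (auto simp: algebra_simps)
    next
      case (Suc k)
      then show ?case using rec[of "m + 2 + k"] by (simp add: distrib_left)
    qed
    have "0 < e * D n" if "n \<ge> m + 2" for n
    proof -
      have "m + 2 + (n - (m + 2)) = n" using that by simp
      then show ?thesis using *[of "n - (m + 2)"] by metis
    qed
    then show ?thesis by blast
  qed
  show ?thesis
  proof (rule ccontr)
    assume no: "\<not> ?thesis"
    have no': "\<not> (\<exists>N. \<forall>m\<ge>N. 0 < 1 * D m)" "\<not> (\<exists>N. \<forall>m\<ge>N. 0 < -1 * D m)"
      using no by (metis insertI1, metis insertI1 insertI2)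
    have alt: "D m * D (Suc m) < 0" for m
    proof (rule ccontr)
      assume "\<not> D m * D (Suc m) < 0"
      then have "0 \<le> 1 * D m \<and> 0 \<le> 1 * D (Suc m) \<or> 0 \<le> -1 * D m \<and> 0 \<le> -1 * D (Suc m)"
        by (auto simp: not_less zero_le_mult_iff)
      then show False
      proof
        assume "0 \<le> 1 * D m \<and> 0 \<le> 1 * D (Suc m)"
        with pos[of 1 m] no' show False by blast
      next
        assume "0 \<le> -1 * D m \<and> 0 \<le> -1 * D (Suc m)"
        with pos[of "-1" m] no' show False by blast
      qed
    qed
    have dec: "\<bar>D (Suc m)\<bar> < \<bar>D m\<bar>" for m
      using alt[of m] alt[of "Suc m"] rec[of m] unfolding mult_less_0_iff by linarith
    have "\<bar>D m\<bar> + int m \<le> \<bar>D 0\<bar>" for m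
    proof (induction m)
      case (Suc m)
      then show ?case using dec[of m] by simp
    qed simp
    from this[of "Suc (nat \<bar>D 0\<bar>)"] show False by simp
  qed
qed

text \<open>
  Let \<open>a, b\<close> be the letter counts of a word \<open>w\<close> with gap \<open>h(w) = 0\<close>, and \<open>H\<^sub>m\<close> the gap of the
  Fibonacci word with index \<open>m + 1\<close>, called \<open>X\<^sub>m\<^sub>+\<^sub>1\<close>. Let \<open>D\<^sub>m\<close> be the determinant of the counts
  of \<open>w\<close> and \<open>X\<^sub>m\<^sub>+\<^sub>1\<close>. Up to sign, \<open>D\<^sub>m\<close> and \<open>D\<^sub>m\<^sub>+\<^sub>1\<close> are the coefficients \<open>j\<close> and \<open>c\<close> for which
  \<open>w\<close> together with \<open>j\<close> copies of \<open>X\<^sub>m\<^sub>+\<^sub>2\<close> has the counts of \<open>c\<close> copies of \<open>X\<^sub>m\<^sub>+\<^sub>1\<close>, and \<open>w\<close>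
  together with \<open>j\<close> copies of \<open>X\<^sub>m\<^sub>+\<^sub>3\<close> those of \<open>c + j\<close> copies. Since the Fibonacci words lie
  alternately on the two sides of the golden frequency, the coefficients are positive for one
  parity of \<open>m\<close>. The gap is linear in the counts except for the concave growth term, so these
  relations bound \<open>H\<^sub>m\<close> by \<open>H\<^sub>m\<^sub>+\<^sub>2\<close> and by a multiple of the slope error.
\<close>
lemma no_word_attains_supremum:
  fixes s :: real
  defines "h \<equiv> \<lambda>w. real (length w) * s - real (count_list w False) * log_alpha - lrho w"
  assumes h_nonneg: "\<And>v. v \<noteq> [] \<Longrightarrow> 0 \<le> h v" and w: "w \<noteq> []"
  shows "h w \<noteq> 0"
proof
  assume hw: "h w = 0"
  have len: "length v = count_list v True + count_list v False" for v :: "bool list"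
    by (induction v) auto
  define a where "a = count_list w True"
  define b where "b = count_list w False"
  define n where "n = a + b"
  have "length w > 0" using w by simp
  then have n: "n > 0" "length w = n" using len[of w] by (simp_all only: n_def a_def b_def)
  define D where "D m = int a * int (fib m) - int b * int (fib (Suc m))" for m
  have rec: "D (Suc (Suc m)) = D (Suc m) + D m" for m
    by (simp add: D_def algebra_simps)
  have "D 0 \<noteq> 0 \<or> D 1 \<noteq> 0" using n by (auto simp: D_def n_def)
  then obtain e N where e: "e \<in> {1, -1}" and N: "\<And>m. m \<ge> N \<Longrightarrow> 0 < e * D m"
    using fib_like_eventually_signed[of D, OF rec] by blast
  \<comment> \<open>The indices for which the Fibonacci word lies between \<open>w\<close> and the golden frequency.\<close>
  define par where "par m \<longleftrightarrow> m \<ge> N \<and> (-1) ^ m = e" for m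
  have par_add: "par m \<Longrightarrow> par (m + 2 * k)" for m k by (simp add: par_def power_add power_mult)
  obtain m0 where m0: "par m0"
  proof -
    have "par (2 * N) \<or> par (Suc (2 * N))" using e by (auto simp: par_def power_mult)
    then show ?thesis using that by blast
  qed
  define H where "H m = h (fword (Suc m))" for m
  have H: "H m = real (fib (Suc (Suc m))) * s - real (fib m) * log_alpha - lrho_fib (Suc m)" for m
    by (simp add: H_def h_def lrho_fib_def len[of "fword (Suc m)"] count_fword_True count_fword_False del: fword.simps)
  have H_nonneg: "0 \<le> H m" for m
    unfolding H_def by (rule h_nonneg) (metis count_fword_True count_list.simps(1) fib_neq_0_nat less_numeral_extra(3) zero_less_Suc)
  have cassini: "int (fib (Suc m)) * int (fib (Suc m)) - int (fib m) * int (fib (Suc (Suc m))) = (-1) ^ m" for m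
    using fib_Cassini_int[of m] by (simp add: power2_eq_square algebra_simps)
  have key: "real j * H (Suc m) \<ge> real c * H m" "real j * H (m + 2) \<ge> real (c + j) * H m"
      "n + j * fib (Suc (Suc (Suc m))) = c * fib (Suc (Suc m))"
      if m: "par m" and j: "int j = (-1) ^ m * D m" and c: "int c = (-1) ^ m * D (Suc m)" for m j c
  proof -
    have j1: "j \<ge> 1" using N[of m] m j unfolding par_def by auto
    define x y where "x = int (fib m)" and "y = int (fib (Suc m))"
    have yx: "y * y - x * (y + x) = (-1) ^ m" using cassini[of m] by (simp add: x_def y_def algebra_simps)
    have Dm: "D m = int a * x - int b * y" "D (Suc m) = int a * y - int b * (y + x)"
      by (simp_all add: D_def x_def y_def)
    have sq: "(-1) ^ m * (-1) ^ m = (1 :: int)" by (simp add: power_mult_distrib[symmetric])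
    have 1: "int a + int j * (y + x) = int c * y"
    proof -
      have "int c * y - int j * (y + x) = (-1) ^ m * (int a * (y * y - x * (y + x)))"
        unfolding c j Dm by (simp add: algebra_simps)
      also have "\<dots> = (-1) ^ m * (-1) ^ m * int a" unfolding yx by simp
      finally show ?thesis unfolding sq by simp
    qed
    have 2: "int b + int j * y = int c * x"
    proof -
      have "int c * x - int j * y = (-1) ^ m * (int b * (y * y - x * (y + x)))"
        unfolding c j Dm by (simp add: algebra_simps)
      also have "\<dots> = (-1) ^ m * (-1) ^ m * int b" unfolding yx by simp
      finally show ?thesis unfolding sq by simp
    qed
    have A: "a + j * fib (Suc (Suc m)) = c * fib (Suc m)"
      using 1 unfolding x_def y_def by (simp del: of_nat_add of_nat_mult add: of_nat_add[symmetric] of_nat_mult[symmetric])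
    have B: "b + j * fib (Suc m) = c * fib m"
      using 2 unfolding x_def y_def by (simp del: of_nat_add of_nat_mult add: of_nat_add[symmetric] of_nat_mult[symmetric])
    show C: "n + j * fib (Suc (Suc (Suc m))) = c * fib (Suc (Suc m))"
      using A B by (simp add: n_def algebra_simps)
    have hw': "lrho w = real n * s - real b * log_alpha" using hw n by (simp add: h_def b_def)
    have "lrho w + real j * lrho (fword (Suc (Suc m))) \<le> real c * lrho (fword (Suc m))"
      by (rule lrho_le_fword[OF all_ge_one_fmat j1])
        (use A B in \<open>simp_all only: count_fword_True count_fword_False a_def b_def\<close>)
    then have "real n * s - real b * log_alpha + real j * lrho_fib (Suc (Suc m)) \<le> real c * lrho_fib (Suc m)"
      by (simp only: hw' lrho_fib_def)
    moreover have "real n + real j * real (fib (Suc (Suc (Suc m)))) = real c * real (fib (Suc (Suc m)))"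
      using C by (metis of_nat_add of_nat_mult)
    moreover have rB: "real b + real j * real (fib (Suc m)) = real c * real (fib m)"
      using B by (metis of_nat_add of_nat_mult)
    moreover have "real j * H (Suc m) - real c * H m =
        (real j * real (fib (Suc (Suc (Suc m)))) - real c * real (fib (Suc (Suc m)))) * s
        - (real j * real (fib (Suc m)) - real c * real (fib m)) * log_alpha
        - (real j * lrho_fib (Suc (Suc m)) - real c * lrho_fib (Suc m))"
      unfolding H by (simp only: algebra_simps)
    ultimately have "real j * H (Suc m) - real c * H m \<ge> 0"
      by (smt (verit) left_diff_distrib mult_minus_left)
    then show "real j * H (Suc m) \<ge> real c * H m" by simp
    have "lrho w + real j * lrho (fword (Suc (Suc (Suc m)))) \<le> real (c + j) * lrho (fword (Suc m))"
      by (rule lrho_le_fword[OF all_ge_one_fmat j1], unfold count_fword_True count_fword_False)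
        (use A B in \<open>simp_all add: a_def b_def algebra_simps\<close>)
    then have "real n * s - real b * log_alpha + real j * lrho_fib (Suc (Suc (Suc m))) \<le> real (c + j) * lrho_fib (Suc m)"
      by (simp only: hw' lrho_fib_def)
    moreover have "real n + real j * real (fib (Suc (Suc (Suc (Suc m))))) = real (c + j) * real (fib (Suc (Suc m)))"
      using arg_cong[OF C, of real] by (simp add: algebra_simps)
    moreover have "real b + real j * real (fib (Suc (Suc m))) = real (c + j) * real (fib m)"
      using rB by (simp add: algebra_simps)
    moreover have "real j * H (m + 2) - real (c + j) * H m =
        (real j * real (fib (Suc (Suc (Suc (Suc m))))) - real (c + j) * real (fib (Suc (Suc m)))) * s
        - (real j * real (fib (Suc (Suc m))) - real (c + j) * real (fib m)) * log_alpha
        - (real j * lrho_fib (Suc (Suc (Suc m))) - real (c + j) * lrho_fib (Suc m))"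
      unfolding H add_2_eq_Suc' by (simp only: algebra_simps)
    ultimately have "real j * H (m + 2) - real (c + j) * H m \<ge> 0"
      by (smt (verit) left_diff_distrib mult_minus_left)
    then show "real j * H (m + 2) \<ge> real (c + j) * H m" by simp
  qed
  have coeffs: "\<exists>j c. int j = (-1) ^ m * D m \<and> int c = (-1) ^ m * D (Suc m) \<and> 0 < j" if "par m" for m
    using N[of m] N[of "Suc m"] that unfolding par_def
    by (intro exI[of _ "nat ((-1) ^ m * D m)"] exI[of _ "nat ((-1) ^ m * D (Suc m))"]) auto
  have mono: "H m \<le> H (m + 2)" if p: "par m" for m
  proof -
    obtain j c where jc: "int j = (-1) ^ m * D m" "int c = (-1) ^ m * D (Suc m)" "0 < j"
      using coeffs[OF p] by blast
    have "real j * H m \<le> real (c + j) * H m" using H_nonneg by (intro mult_right_mono) auto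
    also have "\<dots> \<le> real j * H (m + 2)" using key(2)[OF p jc(1,2)] .
    finally show ?thesis using jc(3) by simp
  qed
  have small: "H m \<le> real (fib (Suc (Suc m))) * slope_error (Suc m)" if p: "par m" for m
  proof -
    obtain j c where jc: "int j = (-1) ^ m * D m" "int c = (-1) ^ m * D (Suc m)" "0 < j"
      using coeffs[OF p] by blast
    have "\<bar>D m\<bar> \<le> int n * int (fib (Suc m))"
    proof -
      have "int a * int (fib m) \<le> int a * int (fib (Suc m))"
        by (intro mult_left_mono) (simp_all add: fib_mono)
      then have "int a * int (fib m) + int b * int (fib (Suc m)) \<le> int n * int (fib (Suc m))"
        by (simp add: n_def algebra_simps del: fib.simps)
      moreover have "0 \<le> int a * int (fib m)" "0 \<le> int b * int (fib (Suc m))" by simp_all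
      ultimately show ?thesis unfolding D_def by linarith
    qed
    moreover have "int j = \<bar>D m\<bar>"
    proof -
      have "\<bar>int j\<bar> = \<bar>D m\<bar>" unfolding jc(1) by (simp add: abs_mult power_abs)
      then show ?thesis by simp
    qed
    moreover have "int n * int (fib (Suc m)) \<le> int n * int (fib (Suc (Suc m)))"
      by (intro mult_left_mono) (simp_all add: fib_mono)
    ultimately have "int j \<le> int (n * fib (Suc (Suc m)))" by (simp only: of_nat_mult)
    then have jn: "real j \<le> real n * real (fib (Suc (Suc m)))" by (metis of_nat_le_iff of_nat_mult)
    define f where "f = real (fib (Suc (Suc m)))"
    define g where "g = real (fib (Suc (Suc (Suc m))))"
    have cf: "real n + real j * g = real c * f"
      using key(3)[OF p jc(1,2)] unfolding f_def g_def by (metis of_nat_add of_nat_mult)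
    have cas: "f * real (fib (Suc m)) - g * real (fib m) = (-1) ^ m"
      using arg_cong[OF cassini[of m], of real_of_int] unfolding f_def g_def by (simp add: algebra_simps)
    \<comment> \<open>Eliminating \<open>c\<close> leaves \<open>f H\<^sub>m\<^sub>+\<^sub>1 - g H\<^sub>m\<close>, from which the unknown rate \<open>s\<close> cancels; by the identity
        of Cassini what remains is the difference between a chord slope and \<open>- ln \<alpha>\<^sub>*\<close>.\<close>
    have "real n * H m + real j * g * H m = f * (real c * H m)"
      using cf by (metis distrib_right mult.assoc mult.commute)
    also have "\<dots> \<le> f * (real j * H (Suc m))"
      using key(1)[OF p jc(1,2)] by (intro mult_left_mono) (auto simp: f_def)
    finally have "real n * H m \<le> real j * (f * H (Suc m) - g * H m)" by (simp add: algebra_simps)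
    also have "f * H (Suc m) - g * H m
      = - (f * real (fib (Suc m)) - g * real (fib m)) * log_alpha - (f * lrho_fib (Suc (Suc m)) - g * lrho_fib (Suc m))"
      unfolding H f_def[symmetric] g_def[symmetric] by (simp add: algebra_simps)
    also have "\<dots> \<le> slope_error (Suc m)"
    proof -
      define d where "d = f * lrho_fib (Suc (Suc m)) - g * lrho_fib (Suc m)"
      have "- ((-1) ^ m) * log_alpha - d = (-1) ^ m * ((-1) ^ Suc m * d - log_alpha)"
        by (simp add: right_diff_distrib mult.assoc[symmetric] power_mult_distrib[symmetric])
      then have "\<bar>- ((-1) ^ m) * log_alpha - d\<bar> = slope_error (Suc m)"
        by (simp add: abs_mult power_abs slope_error_def f_def g_def d_def del: fib.simps)
      then show ?thesis unfolding cas d_def by linarith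
    qed
    finally have "real n * H m \<le> real j * slope_error (Suc m)" by (simp add: mult_left_mono)
    also have "\<dots> \<le> real n * f * slope_error (Suc m)"
      using jn by (intro mult_right_mono) (auto simp: f_def slope_error_def)
    finally show ?thesis using n(1) by (simp add: f_def mult.assoc)
  qed
  have zero: "H m = 0" if p: "par m" for m
  proof -
    have "H m \<le> H (m + 2 * k)" for k
    proof (induction k)
      case (Suc k)
      then show ?case using mono[OF par_add[OF p], of k] by (simp add: add.assoc)
    qed simp
    then have le: "H m \<le> real (fib (Suc (Suc (m + 2 * k)))) * slope_error (Suc (m + 2 * k))" for k
      using small[OF par_add[OF p], of k] order_trans by blast
    have "strict_mono (\<lambda>k. Suc (m + 2 * k))" by (simp add: strict_mono_def)
    from LIMSEQ_subseq_LIMSEQ[OF fib_slope_error_tendsto_0 this]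
    have "(\<lambda>k. real (fib (Suc (Suc (m + 2 * k)))) * slope_error (Suc (m + 2 * k))) \<longlonglongrightarrow> 0"
      by (simp only: o_def)
    then have "H m \<le> 0" by (rule LIMSEQ_le_const) (use le in blast)
    then show ?thesis using H_nonneg[of m] by simp
  qed
  have "H m0 = 0" "H (m0 + 2) = 0" using zero[OF m0] zero[OF par_add[OF m0, of 1]] by simp_all
  \<comment> \<open>Both gaps vanish, but the growth of the concatenation is strictly larger than the sum.\<close>
  moreover have "0 \<le> h (fword (Suc m0) @ fword (Suc (m0 + 2)))"
    by (rule h_nonneg) (use all_ge_one_fmat[of "Suc m0"] in \<open>auto simp: all_ge_one_def\<close>)
  moreover have "h (fword (Suc m0) @ fword (Suc (m0 + 2))) < H m0 + H (m0 + 2)"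
    using lrho_concat_strict[of "Suc m0"]
    by (simp add: H_def h_def lrho_fib_def algebra_simps del: fword.simps)
  ultimately show False by simp
qed

text \<open>
  If the word \<open>w\<close> attained the joint spectral radius \<open>R\<close>, then \<open>ln R\<close> would be a rate \<open>s\<close> for
  which all gaps are nonnegative and that of \<open>w\<close> is \<open>0\<close>.
\<close>
lemma not_finiteness_property: "\<not> finiteness_property (A_alpha alpha_star)"
proof
  assume "finiteness_property (A_alpha alpha_star)"
  then obtain n As where As: "1 \<le> n" "length As = n" "set As \<subseteq> A_alpha alpha_star"
    and jsr: "joint_spectral_radius (A_alpha alpha_star) = ereal (root n (spectral_radius (mat_prod As)))"
    unfolding finiteness_property_def by blast
  have "\<forall>M\<in>set As. \<exists>b. M = letter alpha_star b"
    using As(3) unfolding A_alpha_eq by blast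
  then obtain w where w: "As = map (letter alpha_star) w"
    unfolding ex_map_conv[symmetric] by blast
  have pos: "alpha_star > 0" by (simp add: alpha_star_eq)
  define val where "val v = alpha_star ^ count_list v False * rho v" for v
  have val: "0 < val v" "ln (val v) = real (count_list v False) * log_alpha + lrho v" for v
    using pos rho_ge_1[of v]
    by (simp_all add: val_def ln_mult_pos ln_realpow alpha_star_eq lrho_def)
  define R where "R = root (length w) (val w)"
  have w': "w \<noteq> []" "length w = n" using As w by auto
  have R: "0 < R" unfolding R_def using w' val by (intro real_root_gt_zero) auto
  have jR: "joint_spectral_radius (A_alpha alpha_star) = ereal R"
    using jsr unfolding R_def w spectral_radius_word[OF pos] val_def w'(2) .
  have le: "real (count_list v False) * log_alpha + lrho v \<le> real (length v) * ln R" if "v \<noteq> []" for v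
  proof -
    have "root (length v) (val v) \<le> R"
      using joint_spectral_radius_ge[OF pos that] unfolding jR val_def by simp
    then have "val v \<le> R ^ length v"
      using that val[of v] real_root_pow_pos2[of "length v" "val v"]
        power_mono[of "root (length v) (val v)" R "length v"] by auto
    then have "ln (val v) \<le> ln (R ^ length v)" using val R by (subst ln_le_cancel_iff) auto
    then show ?thesis by (simp add: val ln_realpow)
  qed
  have "R ^ length w = val w"
    unfolding R_def using w' val[of w] by (intro real_root_pow_pos2) auto
  then have "real (length w) * ln R = real (count_list w False) * log_alpha + lrho w"
    using val(2)[of w] ln_realpow[of R "length w"] by simp
  moreover have "real (length w) * ln R - real (count_list w False) * log_alpha - lrho w \<noteq> 0"
  proof (rule no_word_attains_supremum)
    show "0 \<le> real (length v) * ln R - real (count_list v False) * log_alpha - lrho v" if "v \<noteq> []" for v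
      using le[OF that] by simp
  qed (rule w')
  ultimately show False by simp
qed

theorem theorem1p1:
  shows "unconditionally_convergent_prod (\<lambda>n. alpha_factor (Suc n))
       \<and> alpha_seq \<longlonglongrightarrow> alpha_star
       \<and> (\<lambda>n. alpha_factor (Suc n)) has_prod alpha_star
       \<and> 0 < alpha_star \<and> alpha_star \<le> 1
       \<and> \<not> finiteness_property (A_alpha alpha_star)"
proof (intro conjI)
  show "unconditionally_convergent_prod (\<lambda>n. alpha_factor (Suc n))"
    unfolding unconditionally_convergent_prod_def using has_prod_rearranged by blast
  show "alpha_seq \<longlonglongrightarrow> alpha_star"
    unfolding alpha_star_eq by (rule alpha_seq_tendsto)
  show "(\<lambda>n. alpha_factor (Suc n)) has_prod alpha_star"
    using has_prod_rearranged[OF bij_id] by simp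
  show "0 < alpha_star" by (simp add: alpha_star_eq)
qed (fact alpha_star_le_1 not_finiteness_property)+

end
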